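(* Let $p\in(0,1)$ be fixed (independent of $n$). For almost all graphs $G$ in the Erdős–Rényi model $G_{n,p}$, the energy of the arithmetic-geometric matrix $AG_1(G)$ satisfies $$\mathscr{E}(AG_1(G))=(1+o(1))\frac{8}{3\pi}\sqrt{p(1-p)}\cdot n^{3/2}.$$
   Context: $G_{n,p}$ is the model of random simple graphs on vertex set $\{1,\dots,n\}$ in which each edge is present independently with probability $p$; $d_i$ is the degree of vertex $i$ in $G=(V,E)$. $AG_1(G)$ is the $n\times n$ matrix with $(i,j)$-entry $\frac{2\sqrt{d_id_j}}{d_i+d_j}$ if $ij\in E$ and $0$ otherwise. The energy of a real symmetric matrix $A$ with eigenvalues $\lambda_1,\dots,\lambda_n$ is $\mathscr{E}(A)=\sum_{i=1}^n|\lambda_i|$. "Almost all" means with probability tending to $1$ as $n\to\infty$; thus "for almost all graphs, $\mathscr{E}=(1+o(1))g(n)$" means that for every $\varepsilon>0$, $\Pr(|\mathscr{E}/g(n)-1|>\varepsilon)\to0$ as $n\to\infty$. *)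

theory Defs
  imports
    "HOL-Probability.Product_PMF"
    "Jordan_Normal_Form.Char_Poly"
begin

text \<open>
  A simple graph on the vertex set \<open>{1..n}\<close> is represented by its edge set, a subset of
  \<open>vertex_pairs n\<close>.
\<close>

definition vertex_pairs :: "nat \<Rightarrow> nat set set" where
  "vertex_pairs n = {e. e \<subseteq> {1..n} \<and> card e = 2}"

definition gnp :: "nat \<Rightarrow> real \<Rightarrow> nat set set pmf" where
  "gnp n p =
     map_pmf (\<lambda>f. {e \<in> vertex_pairs n. f e})
       (Pi_pmf (vertex_pairs n) False (\<lambda>_. bernoulli_pmf p))"

definition vertex_degree :: "nat set set \<Rightarrow> nat \<Rightarrow> nat" where
  "vertex_degree E v = card {e \<in> E. v \<in> e}"

text \<open>
  Matrix indices start at 0 in the library, so row (column) \<open>i\<close> belongs to the vertex \<open>i + 1\<close>.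
\<close>

definition AG1 :: "nat \<Rightarrow> nat set set \<Rightarrow> real mat" where
  "AG1 n E = mat n n (\<lambda>(i, j).
     let d = \<lambda>k. real (vertex_degree E (Suc k)) in
     if {Suc i, Suc j} \<in> E then 2 * sqrt (d i * d j) / (d i + d j) else 0)"

text \<open>
  The eigenvalues are the roots of the characteristic polynomial, counted with multiplicity.
  The real roots are all of them when the matrix is symmetric, the only case in which this notion
  is meant to be used.
\<close>

definition energy :: "real mat \<Rightarrow> real" where
  "energy A = (\<Sum>x\<in>#proots (char_poly A). \<bar>x\<bar>)"

end

theory Submission
  imports Defs "HOL-Real_Asymp.Real_Asymp"
begin

text \<open>
  Let \<open>A\<close> be the adjacency matrix of \<open>G\<^bsub>n,p\<^esub>\<close>, \<open>M\<close> its arithmetic-geometric matrix, and put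
  \<open>v = p (1 - p)\<close>. The centred and scaled matrix \<open>X = (A - p (J - I)) / sqrt n\<close>, with \<open>J\<close> the
  all-ones matrix, is a Wigner matrix: its entries above the diagonal are independent with mean
  \<open>0\<close> and variance \<open>v / n\<close>. So its spectrum follows the semicircle law of variance \<open>v\<close>, under
  which the mean of \<open>|x|\<close> is \<open>8 sqrt v / (3 \<pi>)\<close>. The proof has two halves.
  
  \<^bold>\<open>From \<open>M\<close> to \<open>X\<close>.\<close> The energy of a symmetric matrix is its trace norm, the largest value of
  \<open>tr (M S)\<close> over symmetric \<open>S\<close> of operator norm at most \<open>1\<close>. Hence a perturbation of small
  Frobenius norm, or a multiple of the rank-one matrix \<open>J\<close>, changes it little
  (\<open>energy_perturbation\<close>). For an edge \<open>ij\<close> the entries of \<open>M\<close> and \<open>A\<close> differ by at most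
  \<open>(|d\<^sub>i - q| + |d\<^sub>j - q|) / q\<close>, where \<open>q = (n - 1) p\<close> is the mean degree, and degrees have variance of
  order \<open>n\<close>. So \<open>M\<close> and \<open>sqrt n X\<close> have energies that differ by \<open>O(n)\<close> in the mean
  (\<open>expected_AG1_energy_deviation\<close>), which is negligible against \<open>n\<^bsup>3/2\<^esup>\<close>.
  
  \<^bold>\<open>The energy of \<open>X\<close>.\<close> The identity \<open>(\<pi> / 2) |x| = \<integral> x\<^sup>2 / (x\<^sup>2 + t\<^sup>2) dt\<close>, integrated over
  \<open>t > 0\<close>, expresses the energy through the resolvent \<open>G = (X - i t)\<^bsup>-1\<^esup>\<close> on the imaginary axis only, namely
  through the integral of \<open>1 - t Im s(t)\<close>, where \<open>s(t) = tr G / n\<close>. There, away from the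
  spectrum, everything is bounded by powers of \<open>1 / t\<close>.
  Let \<open>w\<close> be the mean of \<open>s(t)\<close>. The trace of \<open>(X - i t) G = I\<close> gives
  \<open>1 + i t s = (1 / n) \<Sum> X\<^sub>i\<^sub>j G\<^sub>j\<^sub>i\<close>. A centred Bernoulli variable satisfies an exact integration by parts
  formula (\<open>bernoulli_integration_by_parts\<close>), and changing one edge changes \<open>G\<close> by an explicit
  product of resolvents, so the mean of the right-hand side is \<open>- v\<close> times the mean of \<open>s\<^sup>2\<close>, up to
  \<open>O(1 / sqrt n)\<close>. The Efron-Stein inequality makes the variance of \<open>s\<close> of order \<open>1 / n\<close>, so
  \<open>1 + i t w + v w\<^sup>2\<close> is \<open>O(1 / sqrt n)\<close> (\<open>stieltjes_self_consistent\<close>). The solution of the limiting equation in the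
  upper half plane is \<open>i m(t)\<close> with \<open>m(t) = (sqrt (t\<^sup>2 + 4 v) - t) / (2 v)\<close>, and it is stable for a simple
  algebraic reason (\<open>self_consistent_stability\<close>). It remains to integrate \<open>1 - t m(t)\<close> over
  \<open>t > 0\<close>, which gives \<open>4 sqrt v / 3\<close>.
  
  The two halves yield convergence of the scaled energy in mean, and Markov's inequality turns it into
  convergence in probability.
\<close>

(* From here on, v $ i always denotes an entry of a vector whose dimension is not part of its type. *)
unbundle no vec_syntax

section \<open>The spectral theorem for real symmetric matrices\<close>

text \<open>
  The characteristic polynomial has a complex root \<open>z\<close>. For an eigenvector \<open>v\<close> of it,
  the number \<open>v\<^sup>* A v\<close> equals both \<open>z\<close> and its conjugate times the squared norm of \<open>v\<close>.
\<close>

lemma real_symmetric_eigenvalue_exists: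
  fixes A :: "real mat"
  assumes A: "A \<in> carrier_mat n n" and sym: "A\<^sup>T = A" and n: "n > 0"
  obtains e where "eigenvalue A e"
proof -
  let ?B = "map_mat complex_of_real A"
  have B: "?B \<in> carrier_mat n n" using A by simp
  have cp: "char_poly ?B = map_poly of_real (char_poly A)"
    by (rule of_real_hom.char_poly_hom[OF A])
  have "degree (char_poly ?B) = n"
    using degree_monic_char_poly[OF B] by simp
  then have "\<not> constant (poly (char_poly ?B))"
    using n by (simp add: constant_degree)
  then obtain z where z: "poly (char_poly ?B) z = 0"
    using fundamental_theorem_of_algebra by blast
  then have "eigenvalue ?B z"
    using eigenvalue_root_char_poly[OF B] by simp
  then obtain v where v: "v \<in> carrier_vec n" "v \<noteq> 0\<^sub>v n" "?B *\<^sub>v v = z \<cdot>\<^sub>v v"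
    using B unfolding eigenvalue_def eigenvector_def by auto
  have sA: "A $$ (i,j) = A $$ (j,i)" if "i < n" "j < n" for i j
    using sym A that by (metis carrier_matD index_transpose_mat(1))
  have ev: "(\<Sum>j<n. of_real (A $$ (i,j)) * v $ j) = z * v $ i" if i: "i < n" for i
  proof -
    have "(?B *\<^sub>v v) $ i = (z \<cdot>\<^sub>v v) $ i" using v by simp
    then show ?thesis using i A v(1)
      by (simp add: scalar_prod_def atLeast0LessThan)
  qed
  let ?N = "\<Sum>i<n. cnj (v $ i) * v $ i"
  have "z * ?N = (\<Sum>i<n. \<Sum>j<n. cnj (v $ i) * of_real (A $$ (i,j)) * v $ j)"
    (is "_ = ?S")
  proof -
    have "z * ?N = (\<Sum>i<n. cnj (v $ i) * (z * v $ i))"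
      by (simp add: sum_distrib_left mult_ac)
    also have "\<dots> = (\<Sum>i<n. cnj (v $ i) * (\<Sum>j<n. of_real (A $$ (i,j)) * v $ j))"
      by (intro sum.cong refl) (simp add: ev)
    finally show ?thesis by (simp add: sum_distrib_left mult.assoc)
  qed
  also have "\<dots> = (\<Sum>j<n. \<Sum>i<n. cnj (v $ i) * of_real (A $$ (i,j)) * v $ j)"
    by (rule sum.swap)
  also have "\<dots> = (\<Sum>j<n. cnj (z * v $ j) * v $ j)"
  proof (intro sum.cong refl)
    fix j assume "j \<in> {..<n}"
    then show "(\<Sum>i<n. cnj (v $ i) * of_real (A $$ (i,j)) * v $ j) = cnj (z * v $ j) * v $ j"
      by (simp add: ev[symmetric] sum_distrib_left sum_distrib_right sA mult_ac)
  qed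
  also have "\<dots> = cnj z * ?N"
    by (simp add: sum_distrib_left mult_ac)
  finally have eq: "(z - cnj z) * ?N = 0" by (simp add: algebra_simps)
  have "?N = of_real (\<Sum>i<n. (cmod (v $ i))\<^sup>2)"
    by (simp add: complex_norm_square mult.commute del: of_real_power)
  moreover have "(\<Sum>i<n. (cmod (v $ i))\<^sup>2) \<noteq> 0"
  proof
    assume "(\<Sum>i<n. (cmod (v $ i))\<^sup>2) = 0"
    then have "\<And>i. i < n \<Longrightarrow> v $ i = 0" by (simp add: sum_nonneg_eq_0_iff)
    then show False using v(1,2) by (metis carrier_vecD eq_vecI index_zero_vec(1) index_zero_vec(2))
  qed
  ultimately have "?N \<noteq> 0" by (metis of_real_eq_0_iff)
  with eq have "z = cnj z" by simp
  then have "z \<in> \<real>" by (metis Reals_cnj_iff)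
  then obtain e where "z = of_real e" by (auto elim: Reals_cases)
  with z cp have "poly (char_poly A) e = 0" by simp
  then show ?thesis
    using eigenvalue_root_char_poly[OF A] that by blast
qed

text \<open>
  The matrix is the Householder reflection in the hyperplane orthogonal to \<open>w = v - e\<^sub>0\<close>, which swaps
  the unit vectors \<open>e\<^sub>0\<close> and \<open>v\<close>. Here \<open>c\<close> is half the squared norm of \<open>w\<close>. If \<open>v = e\<^sub>0\<close> then \<open>c = 0\<close>, and
  division by zero makes the formula the identity matrix.
\<close>

lemma orthogonal_mat_with_first_column:
  fixes v :: "real vec"
  assumes v: "v \<in> carrier_vec n" and n: "n > 0" and unit: "(\<Sum>i<n. (v $ i)\<^sup>2) = 1"
  obtains W :: "real mat" where "W \<in> carrier_mat n n" "W\<^sup>T * W = 1\<^sub>m n" "W * W\<^sup>T = 1\<^sub>m n"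
    "col W 0 = v"
proof -
  define w where "w i = v $ i - (if i = 0 then 1 else 0)" for i
  define c where "c = 1 - v $ 0"
  define W where "W = mat n n (\<lambda>(i,j). (if i = j then 1 else 0) - w i * w j / c)"
  have wsq: "(\<Sum>k<n. w k * w k) = 2 * c"
  proof -
    have "(\<Sum>k<n. w k * w k) = (\<Sum>k<n. (v $ k)\<^sup>2 + (if k = 0 then 1 - 2 * v $ 0 else 0))"
      by (intro sum.cong) (auto simp: w_def power2_eq_square algebra_simps)
    also have "\<dots> = 2 * c"
      using n by (simp add: sum.distrib unit c_def)
    finally show ?thesis .
  qed
  have WC: "W \<in> carrier_mat n n" by (simp add: W_def)
  have c0: "w k = 0" if "c = 0" "k < n" for k
    using wsq that by (simp add: sum_nonneg_eq_0_iff)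
  have Wt: "W\<^sup>T = W" by (rule eq_matI) (auto simp: W_def)
  have WW: "W * W = 1\<^sub>m n"
  proof (rule eq_matI)
    fix i j assume "i < dim_row (1\<^sub>m n :: real mat)" "j < dim_col (1\<^sub>m n :: real mat)"
    then have ij: "i < n" "j < n" by auto
    have "(W * W) $$ (i,j) =
        (\<Sum>k<n. ((if i = k then 1 else 0) - w i * w k / c) * ((if k = j then 1 else 0) - w k * w j / c))"
      using ij by (simp add: W_def scalar_prod_def atLeast0LessThan)
    also have "\<dots> = (\<Sum>k<n. (if i = k then (if i = j then 1 else 0) - w i * w j / c else 0)
         - (if k = j then w i * w j / c else 0) + w i * w j / (c * c) * (w k * w k))"
      by (intro sum.cong refl) (auto simp: algebra_simps)
    also have "\<dots> = (if i = j then 1 else 0) - 2 * (w i * w j / c) + w i * w j / (c * c) * (2 * c)"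
      using ij by (simp only: sum.distrib sum_subtractf sum_distrib_left[symmetric] wsq) simp
    also have "\<dots> = (if i = j then 1 else 0)"
      using c0 ij by (cases "c = 0") (auto simp: field_simps)
    finally show "(W * W) $$ (i,j) = 1\<^sub>m n $$ (i,j)" using ij by simp
  qed (auto simp: W_def)
  have "col W 0 = v"
  proof (rule eq_vecI)
    fix i assume "i < dim_vec v"
    then have i: "i < n" using v by simp
    have "w 0 = - c" by (simp add: w_def c_def)
    then have "(if i = 0 then 1 else 0) - w i * w 0 / c = (if i = 0 then 1 else 0) + w i"
      using c0 i by (cases "c = 0") auto
    then show "col W 0 $ i = v $ i" using i n by (simp add: W_def w_def)
  qed (use v in \<open>auto simp: W_def\<close>)
  then show ?thesis using that WC WW Wt by metis
qed

definition spectral_decomposition :: "nat \<Rightarrow> real mat \<Rightarrow> real mat \<Rightarrow> (nat \<Rightarrow> real) \<Rightarrow> bool" where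
  "spectral_decomposition n A U d \<longleftrightarrow>
     U \<in> carrier_mat n n \<and> U\<^sup>T * U = 1\<^sub>m n \<and> U * U\<^sup>T = 1\<^sub>m n \<and> A = U * mat_diag n d * U\<^sup>T"

text \<open>
  Conjugation by an orthogonal matrix whose first column is a unit eigenvector
  splits off a \<open>1 \<times> 1\<close> block. By symmetry the rest of the first row vanishes as well, and the induction
  hypothesis applies to the complementary block.
\<close>

theorem real_spectral_theorem:
  fixes A :: "real mat"
  assumes "A \<in> carrier_mat n n" and "A\<^sup>T = A"
  shows "\<exists>U d. spectral_decomposition n A U d"
  using assms
proof (induction n arbitrary: A)
  case 0
  show ?case
    by (rule exI[of _ "1\<^sub>m 0"], rule exI[of _ "\<lambda>_. 0"])
      (use 0 in \<open>auto simp: spectral_decomposition_def\<close>)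
next
  case (Suc m A)
  note A = Suc.prems(1) and sym = Suc.prems(2)
  obtain e where "eigenvalue A e"
    using real_symmetric_eigenvalue_exists[OF A sym] by blast
  then obtain x where x: "x \<in> carrier_vec (Suc m)" "x \<noteq> 0\<^sub>v (Suc m)" "A *\<^sub>v x = e \<cdot>\<^sub>v x"
    using A unfolding eigenvalue_def eigenvector_def by auto
  define N where "N = (\<Sum>i<Suc m. (x $ i)\<^sup>2)"
  have "N \<noteq> 0"
  proof
    assume "N = 0"
    then have "\<And>i. i < Suc m \<Longrightarrow> x $ i = 0"
      unfolding N_def by (subst (asm) sum_nonneg_eq_0_iff) auto
    then show False using x(1,2) by (metis carrier_vecD eq_vecI index_zero_vec(1) index_zero_vec(2))
  qed
  moreover have "N \<ge> 0" unfolding N_def by (intro sum_nonneg) auto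
  ultimately have N: "N > 0" by simp
  define v where "v = (1 / sqrt N) \<cdot>\<^sub>v x"
  have v: "v \<in> carrier_vec (Suc m)" using x by (simp add: v_def)
  have Av: "A *\<^sub>v v = e \<cdot>\<^sub>v v"
    unfolding v_def using mult_mat_vec[OF A x(1)] x(3) by (simp add: smult_smult_assoc mult.commute)
  have "(\<Sum>i<Suc m. (v $ i)\<^sup>2) = (\<Sum>i<Suc m. (x $ i)\<^sup>2 / N)"
    using x N by (intro sum.cong refl) (auto simp: v_def power_divide)
  also have "\<dots> = 1" using N by (simp add: sum_divide_distrib[symmetric] N_def)
  finally have unit: "(\<Sum>i<Suc m. (v $ i)\<^sup>2) = 1" .
  obtain W :: "real mat" where W: "W \<in> carrier_mat (Suc m) (Suc m)" "W\<^sup>T * W = 1\<^sub>m (Suc m)"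
      "W * W\<^sup>T = 1\<^sub>m (Suc m)" "col W 0 = v"
    using orthogonal_mat_with_first_column[OF v _ unit] by blast
  define A' where "A' = W\<^sup>T * A * W"
  have Wt: "W\<^sup>T \<in> carrier_mat (Suc m) (Suc m)" using W by simp
  have A': "A' \<in> carrier_mat (Suc m) (Suc m)" using A W by (simp add: A'_def)
  have symA': "A'\<^sup>T = A'"
    using A W(1) sym by (simp add: A'_def transpose_mult[of _ "Suc m" "Suc m" _ "Suc m"]
        assoc_mult_mat[of _ "Suc m" "Suc m" _ "Suc m" _ "Suc m"])
  have AA': "A = W * A' * W\<^sup>T"
  proof -
    have "W * A' * W\<^sup>T = (W * W\<^sup>T) * A * (W * W\<^sup>T)"
      unfolding A'_def using A W(1) Wt
      by (simp add: assoc_mult_mat[of _ "Suc m" "Suc m" _ "Suc m" _ "Suc m"] del: W(3))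
    also have "\<dots> = A" using A unfolding W(3) by simp
    finally show ?thesis by simp
  qed
  have col0: "A' $$ (i,0) = (if i = 0 then e else 0)" if i: "i < Suc m" for i
  proof -
    have "col A' 0 = (W\<^sup>T * A) *\<^sub>v col W 0"
      unfolding A'_def using A W(1) Wt by (intro col_mult2[of _ "Suc m" "Suc m" _ "Suc m"]) auto
    also have "\<dots> = W\<^sup>T *\<^sub>v (A *\<^sub>v col W 0)"
      using A W(1,4) Wt v by (intro assoc_mult_mat_vec[of _ "Suc m" "Suc m" _ "Suc m"]) auto
    also have "\<dots> = e \<cdot>\<^sub>v (W\<^sup>T *\<^sub>v col W 0)"
      using Av W v mult_mat_vec[OF Wt v] by simp
    also have "W\<^sup>T *\<^sub>v col W 0 = col (W\<^sup>T * W) 0"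
      using W(1) Wt by (intro col_mult2[symmetric, of _ "Suc m" "Suc m" _ "Suc m"]) auto
    finally have "col A' 0 $ i = (e \<cdot>\<^sub>v col (1\<^sub>m (Suc m)) 0) $ i" using W(2) by simp
    then show ?thesis using i A' by simp
  qed
  have row0: "A' $$ (0,i) = (if i = 0 then e else 0)" if i: "i < Suc m" for i
    using col0[OF i] symA' A' i by (metis carrier_matD index_transpose_mat(1) zero_less_Suc)
  define A3 where "A3 = mat m m (\<lambda>(i,j). A' $$ (Suc i, Suc j))"
  have A3: "A3 \<in> carrier_mat m m" by (simp add: A3_def)
  have "A3\<^sup>T = A3"
  proof (rule eq_matI)
    fix i j assume "i < dim_row A3" "j < dim_col A3"
    then have ij: "Suc i < Suc m" "Suc j < Suc m" by (auto simp: A3_def)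
    have "A' $$ (Suc i, Suc j) = A' $$ (Suc j, Suc i)"
      using ij A' by (metis symA' carrier_matD index_transpose_mat(1))
    then show "A3\<^sup>T $$ (i,j) = A3 $$ (i,j)" using ij by (simp add: A3_def)
  qed (auto simp: A3_def)
  from Suc.IH[OF A3 this] obtain U3 d3 where
    U3: "U3 \<in> carrier_mat m m" "U3\<^sup>T * U3 = 1\<^sub>m m" "U3 * U3\<^sup>T = 1\<^sub>m m"
    and A3eq: "A3 = U3 * mat_diag m d3 * U3\<^sup>T"
    unfolding spectral_decomposition_def by blast
  define V where "V = four_block_mat (1\<^sub>m 1) (0\<^sub>m 1 m) (0\<^sub>m m 1) U3"
  define d where "d k = (case k of 0 \<Rightarrow> e | Suc i \<Rightarrow> d3 i)" for k
  have V: "V \<in> carrier_mat (Suc m) (Suc m)"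
    using U3(1) unfolding V_def by (intro carrier_matI) auto
  have Vt: "V\<^sup>T = four_block_mat (1\<^sub>m 1) (0\<^sub>m 1 m) (0\<^sub>m m 1) (U3\<^sup>T)"
    using U3 unfolding V_def by (subst transpose_four_block_mat[of _ 1 1 _ m _ m]) auto
  have one: "four_block_mat (1\<^sub>m 1) (0\<^sub>m 1 m) (0\<^sub>m m 1) (1\<^sub>m m) = (1\<^sub>m (Suc m) :: real mat)"
    by (rule eq_matI) auto
  have VtV: "V\<^sup>T * V = 1\<^sub>m (Suc m)"
    unfolding Vt unfolding V_def
    using U3 by (subst mult_four_block_mat[of _ 1 1 _ m _ m _ _ 1 _ m]) (auto simp: one)
  have VVt: "V * V\<^sup>T = 1\<^sub>m (Suc m)"
    unfolding Vt unfolding V_def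
    using U3 by (subst mult_four_block_mat[of _ 1 1 _ m _ m _ _ 1 _ m]) (auto simp: one)
  have D: "mat_diag (Suc m) d = four_block_mat (mat_diag 1 (\<lambda>_. e)) (0\<^sub>m 1 m) (0\<^sub>m m 1) (mat_diag m d3)"
    by (rule eq_matI) (auto simp: mat_diag_def d_def split: nat.split)
  have "V * mat_diag (Suc m) d * V\<^sup>T =
      four_block_mat (mat_diag 1 (\<lambda>_. e)) (0\<^sub>m 1 m) (0\<^sub>m m 1) (U3 * mat_diag m d3 * U3\<^sup>T)"
  proof -
    have "V * mat_diag (Suc m) d = four_block_mat (mat_diag 1 (\<lambda>_. e)) (0\<^sub>m 1 m) (0\<^sub>m m 1) (U3 * mat_diag m d3)"
      unfolding D V_def using U3(1) left_mult_one_mat[of "mat_diag 1 (\<lambda>_. e)" 1 1]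
        left_mult_zero_mat[of "mat_diag m d3" m m] left_mult_zero_mat[of "mat_diag 1 (\<lambda>_. e)" 1 1]
        right_mult_zero_mat[of U3 m m]
      by (subst mult_four_block_mat[of _ 1 1 _ m _ m _ _ 1 _ m]) auto
    moreover have "four_block_mat (mat_diag 1 (\<lambda>_. e)) (0\<^sub>m 1 m) (0\<^sub>m m 1) (U3 * mat_diag m d3) * V\<^sup>T
        = four_block_mat (mat_diag 1 (\<lambda>_. e)) (0\<^sub>m 1 m) (0\<^sub>m m 1) (U3 * mat_diag m d3 * U3\<^sup>T)"
      unfolding Vt using U3(1) right_mult_one_mat[of "mat_diag 1 (\<lambda>_. e)" 1 1]
        left_mult_zero_mat[of "U3\<^sup>T" m m] right_mult_zero_mat[of "mat_diag 1 (\<lambda>_. e)" 1 1]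
        right_mult_zero_mat[of "U3 * mat_diag m d3" m m]
      by (subst mult_four_block_mat[of _ 1 1 _ m _ m _ _ 1 _ m]) auto
    ultimately show ?thesis by simp
  qed
  also have "\<dots> = A'"
    unfolding A3eq[symmetric]
    by (rule eq_matI) (use A' col0 row0 in \<open>auto simp: A3_def mat_diag_def\<close>)
  finally have A'eq: "A' = V * mat_diag (Suc m) d * V\<^sup>T" ..
  let ?U = "W * V"
  have Ut: "?U\<^sup>T = V\<^sup>T * W\<^sup>T"
    using W V by (simp add: transpose_mult[of _ "Suc m" "Suc m" _ "Suc m"])
  have Vtc: "V\<^sup>T \<in> carrier_mat (Suc m) (Suc m)" using V by simp
  note assoc = assoc_mult_mat[of _ "Suc m" "Suc m" _ "Suc m" _ "Suc m"]
  have "?U\<^sup>T * ?U = V\<^sup>T * ((W\<^sup>T * W) * V)"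
    unfolding Ut using W(1) V Wt Vtc by (simp add: assoc)
  then have 1: "?U\<^sup>T * ?U = 1\<^sub>m (Suc m)" using W V VtV by simp
  have "?U * ?U\<^sup>T = W * ((V * V\<^sup>T) * W\<^sup>T)"
    unfolding Ut using W(1) V Wt Vtc by (simp add: assoc)
  then have 2: "?U * ?U\<^sup>T = 1\<^sub>m (Suc m)" using W V VVt by simp
  have 3: "A = ?U * mat_diag (Suc m) d * ?U\<^sup>T"
  proof -
    let ?D = "mat_diag (Suc m) d"
    have c: "?D \<in> carrier_mat (Suc m) (Suc m)" "V * ?D \<in> carrier_mat (Suc m) (Suc m)"
      using V by auto
    have "A = (W * (V * ?D)) * V\<^sup>T * W\<^sup>T"
      unfolding AA' A'eq using assoc[OF W(1) c(2) Vtc] by simp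
    also have "\<dots> = (W * (V * ?D)) * (V\<^sup>T * W\<^sup>T)"
      by (rule assoc) (use c W(1) Vtc Wt in auto)
    also have "W * (V * ?D) = W * V * ?D"
      using assoc[OF W(1) V c(1)] by simp
    finally show ?thesis unfolding Ut .
  qed
  have "spectral_decomposition (Suc m) A ?U d"
    unfolding spectral_decomposition_def using 1 2 3 W V by auto
  then show ?case by blast
qed

lemma energy_spectral_decomposition:
  assumes "spectral_decomposition n A U d"
  shows "energy A = (\<Sum>k<n. \<bar>d k\<bar>)"
proof -
  have U: "U \<in> carrier_mat n n" "U\<^sup>T * U = 1\<^sub>m n" "U * U\<^sup>T = 1\<^sub>m n" "A = U * mat_diag n d * U\<^sup>T"
    using assms by (auto simp: spectral_decomposition_def)
  have "similar_mat A (mat_diag n d)"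
    by (rule similar_matI[of _ _ U "U\<^sup>T" n]) (use U in auto)
  then have "char_poly A = char_poly (mat_diag n d)" by (rule char_poly_similar)
  also have "\<dots> = (\<Prod>a\<leftarrow>diag_mat (mat_diag n d). [:- a, 1:])"
    by (rule char_poly_upper_triangular[of _ n]) (auto simp: mat_diag_def)
  also have "diag_mat (mat_diag n d) = map d [0..<n]"
    by (auto simp: diag_mat_def mat_diag_def)
  finally have "char_poly A = (\<Prod>a\<leftarrow>map d [0..<n]. [:- a, 1:])" .
  moreover have "proots (\<Prod>a\<leftarrow>xs. [:- a, 1:]) = mset xs" for xs :: "real list"
  proof (induction xs)
    case (Cons a xs)
    have "(\<Prod>a\<leftarrow>xs. [:- a, 1:]) \<noteq> 0" by (auto simp: prod_list_zero_iff)
    then have "proots ([:- a, 1:] * (\<Prod>a\<leftarrow>xs. [:- a, 1:])) = {#a#} + mset xs"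
      using Cons by (subst proots_mult) auto
    then show ?case by simp
  qed auto
  ultimately have "proots (char_poly A) = mset (map d [0..<n])" by metis
  then show ?thesis
    unfolding energy_def
    by (simp add: image_mset.compositionality o_def sum_unfold_sum_mset atLeast0LessThan[symmetric])
qed

section \<open>Perturbation of the energy\<close>

lemma spectral_decomposition_entries:
  assumes "spectral_decomposition n A U d"
  shows orthonormal_columns: "\<And>k l. k < n \<Longrightarrow> l < n \<Longrightarrow>
          (\<Sum>i<n. U $$ (i,k) * U $$ (i,l)) = (if k = l then 1 else 0)"
    and orthonormal_rows: "\<And>i j. i < n \<Longrightarrow> j < n \<Longrightarrow>
          (\<Sum>k<n. U $$ (i,k) * U $$ (j,k)) = (if i = j then 1 else 0)"
    and spectral_entry: "\<And>i j. i < n \<Longrightarrow> j < n \<Longrightarrow>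
          A $$ (i,j) = (\<Sum>k<n. d k * (U $$ (i,k) * U $$ (j,k)))"
proof -
  have U: "U \<in> carrier_mat n n" "U\<^sup>T * U = 1\<^sub>m n" "U * U\<^sup>T = 1\<^sub>m n" "A = U * mat_diag n d * U\<^sup>T"
    using assms by (auto simp: spectral_decomposition_def)
  show "(\<Sum>i<n. U $$ (i,k) * U $$ (i,l)) = (if k = l then 1 else 0)" if "k < n" "l < n" for k l
  proof -
    have "(U\<^sup>T * U) $$ (k,l) = (if k = l then 1 else 0)" unfolding U(2) using that by simp
    then show ?thesis using that U(1) by (simp add: scalar_prod_def atLeast0LessThan)
  qed
  show "(\<Sum>k<n. U $$ (i,k) * U $$ (j,k)) = (if i = j then 1 else 0)" if "i < n" "j < n" for i j
  proof -
    have "(U * U\<^sup>T) $$ (i,j) = (if i = j then 1 else 0)" unfolding U(3) using that by simp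
    then show ?thesis using that U(1) by (simp add: scalar_prod_def atLeast0LessThan)
  qed
  show "A $$ (i,j) = (\<Sum>k<n. d k * (U $$ (i,k) * U $$ (j,k)))" if "i < n" "j < n" for i j
    unfolding U(4) mat_diag_mult_right[OF U(1)]
    using that U(1) by (simp add: scalar_prod_def atLeast0LessThan mult_ac)
qed

text \<open>
  Parseval's identity for the rows of an orthogonal matrix.
\<close>

lemma orthogonal_sum_squares:
  fixes u :: "nat \<Rightarrow> nat \<Rightarrow> real"
  assumes "\<And>i j. i < n \<Longrightarrow> j < n \<Longrightarrow> (\<Sum>k<n. u i k * u j k) = (if i = j then 1 else 0)"
  shows "(\<Sum>k<n. (\<Sum>i<n. x i * u i k)\<^sup>2) = (\<Sum>i<n. (x i)\<^sup>2)"
proof -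
  have "(\<Sum>k<n. (\<Sum>i<n. x i * u i k)\<^sup>2)
      = (\<Sum>k<n. \<Sum>i<n. \<Sum>j<n. x i * x j * (u i k * u j k))"
    by (simp add: power2_eq_square sum_product mult_ac)
  also have "\<dots> = (\<Sum>i<n. \<Sum>j<n. \<Sum>k<n. x i * x j * (u i k * u j k))"
    by (subst sum.swap, rule sum.cong[OF refl], subst sum.swap) simp
  also have "\<dots> = (\<Sum>i<n. \<Sum>j<n. if i = j then x i * x j else 0)"
    by (intro sum.cong refl) (auto simp: sum_distrib_left[symmetric] assms)
  also have "\<dots> = (\<Sum>i<n. (x i)\<^sup>2)"
    by (simp add: power2_eq_square)
  finally show ?thesis .
qed

text \<open>
  Let \<open>S = sgn A\<close> in the sense of the functional calculus. Then \<open>tr (A S)\<close> is the energy of \<open>A\<close>, while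
  \<open>tr (B S)\<close> is at most the energy of \<open>B\<close> because \<open>S\<close> has operator norm at most \<open>1\<close>. The
  difference \<open>A - B\<close> is the sum of \<open>c J\<close> and a remainder \<open>R\<close>: the former contributes at most \<open>|c| n\<close>
  since \<open>J\<close> has the only nonzero eigenvalue \<open>n\<close>, and for the latter the arithmetic-geometric mean inequality bounds
  \<open>tr (R S)\<close> by half the sum of the squared Frobenius norms, that of \<open>S\<close> being at most \<open>n\<close>.
\<close>

lemma energy_perturbation:
  fixes A B :: "real mat"
  assumes A: "A \<in> carrier_mat n n" "A\<^sup>T = A" and B: "B \<in> carrier_mat n n" "B\<^sup>T = B"
  shows "energy A \<le> energy B + ((\<Sum>i<n. \<Sum>j<n. (A $$ (i,j) - B $$ (i,j) - c)\<^sup>2) + real n) / 2 + \<bar>c\<bar> * real n"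
proof -
  obtain U d where dA: "spectral_decomposition n A U d"
    using real_spectral_theorem[OF A] by blast
  obtain V e where dB: "spectral_decomposition n B V e"
    using real_spectral_theorem[OF B] by blast
  note A1 = orthonormal_columns[OF dA] and A2 = orthonormal_rows[OF dA] and A3 = spectral_entry[OF dA]
  note B1 = orthonormal_columns[OF dB] and B2 = orthonormal_rows[OF dB] and B3 = spectral_entry[OF dB]
  define S where "S i j = (\<Sum>k<n. sgn (d k) * (U $$ (i,k) * U $$ (j,k)))" for i j
  define q where "q y l = (\<Sum>i<n. y i * V $$ (i,l))" for y l
  have trA: "(\<Sum>i<n. \<Sum>j<n. A $$ (i,j) * S i j) = (\<Sum>k<n. \<bar>d k\<bar>)"
  proof -
    have "(\<Sum>i<n. \<Sum>j<n. A $$ (i,j) * S i j) =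
      (\<Sum>i<n. \<Sum>j<n. \<Sum>k<n. \<Sum>l<n. d k * sgn (d l) * ((U $$ (i,k) * U $$ (i,l)) * (U $$ (j,k) * U $$ (j,l))))"
      by (intro sum.cong refl) (simp add: A3 S_def sum_product mult_ac)
    also have "\<dots> = (\<Sum>i<n. \<Sum>k<n. \<Sum>l<n. \<Sum>j<n. d k * sgn (d l) * ((U $$ (i,k) * U $$ (i,l)) * (U $$ (j,k) * U $$ (j,l))))"
      by (rule sum.cong[OF refl], subst sum.swap, rule sum.cong[OF refl], subst sum.swap) simp
    also have "\<dots> = (\<Sum>k<n. \<Sum>l<n. \<Sum>i<n. \<Sum>j<n. d k * sgn (d l) * ((U $$ (i,k) * U $$ (i,l)) * (U $$ (j,k) * U $$ (j,l))))"
      by (subst sum.swap, rule sum.cong[OF refl], subst sum.swap) simp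
    also have "\<dots> = (\<Sum>k<n. \<Sum>l<n. d k * sgn (d l) * ((\<Sum>i<n. U $$ (i,k) * U $$ (i,l)) * (\<Sum>j<n. U $$ (j,k) * U $$ (j,l))))"
      by (simp only: sum_product) (simp only: sum_distrib_left)
    also have "\<dots> = (\<Sum>k<n. \<Sum>l<n. if k = l then d k * sgn (d l) else 0)"
      by (intro sum.cong refl) (simp add: A1)
    also have "\<dots> = (\<Sum>k<n. \<bar>d k\<bar>)"
      by (simp add: abs_sgn)
    finally show ?thesis .
  qed
  have trB: "(\<Sum>i<n. \<Sum>j<n. B $$ (i,j) * S i j) \<le> (\<Sum>l<n. \<bar>e l\<bar>)"
  proof -
    have "(\<Sum>i<n. \<Sum>j<n. B $$ (i,j) * S i j) =
      (\<Sum>i<n. \<Sum>j<n. \<Sum>l<n. \<Sum>k<n. e l * sgn (d k) * ((U $$ (i,k) * V $$ (i,l)) * (U $$ (j,k) * V $$ (j,l))))"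
      by (intro sum.cong refl) (simp add: B3 S_def sum_product mult_ac)
    also have "\<dots> = (\<Sum>i<n. \<Sum>l<n. \<Sum>k<n. \<Sum>j<n. e l * sgn (d k) * ((U $$ (i,k) * V $$ (i,l)) * (U $$ (j,k) * V $$ (j,l))))"
      by (rule sum.cong[OF refl], subst sum.swap, rule sum.cong[OF refl], subst sum.swap) simp
    also have "\<dots> = (\<Sum>l<n. \<Sum>k<n. \<Sum>i<n. \<Sum>j<n. e l * sgn (d k) * ((U $$ (i,k) * V $$ (i,l)) * (U $$ (j,k) * V $$ (j,l))))"
      by (subst sum.swap, rule sum.cong[OF refl], subst sum.swap) simp
    also have "\<dots> = (\<Sum>l<n. \<Sum>k<n. e l * sgn (d k) * (q (\<lambda>i. U $$ (i,k)) l)\<^sup>2)"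
      unfolding q_def power2_eq_square by (simp only: sum_product) (simp only: sum_distrib_left)
    also have "\<dots> \<le> (\<Sum>l<n. \<Sum>k<n. \<bar>e l\<bar> * (q (\<lambda>i. U $$ (i,k)) l)\<^sup>2)"
    proof (intro sum_mono mult_right_mono)
      fix l k
      have "e l * sgn (d k) \<le> \<bar>e l * sgn (d k)\<bar>" by simp
      also have "\<dots> \<le> \<bar>e l\<bar>" by (simp add: abs_mult sgn_if)
      finally show "e l * sgn (d k) \<le> \<bar>e l\<bar>" .
    qed auto
    also have "\<dots> = (\<Sum>l<n. \<bar>e l\<bar> * (\<Sum>k<n. (\<Sum>i<n. V $$ (i,l) * U $$ (i,k))\<^sup>2))"
      by (simp add: sum_distrib_left q_def mult.commute)
    also have "\<dots> = (\<Sum>l<n. \<bar>e l\<bar> * 1)"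
    proof (intro sum.cong refl arg_cong2[where f="(*)"])
      fix l assume "l \<in> {..<n}"
      then show "(\<Sum>k<n. (\<Sum>i<n. V $$ (i,l) * U $$ (i,k))\<^sup>2) = 1"
        using orthogonal_sum_squares[OF A2, of "\<lambda>i. V $$ (i,l)"] B1[of l l] by (simp add: power2_eq_square)
    qed
    finally show ?thesis by simp
  qed
  have S2: "(\<Sum>i<n. \<Sum>j<n. (S i j)\<^sup>2) \<le> real n"
  proof -
    have "(\<Sum>j<n. (S i j)\<^sup>2) \<le> 1" if i: "i < n" for i
    proof -
      have "(\<Sum>j<n. (S i j)\<^sup>2) = (\<Sum>j<n. (\<Sum>k<n. (sgn (d k) * U $$ (i,k)) * U $$ (j,k))\<^sup>2)"
        by (simp add: S_def mult_ac)
      also have "\<dots> = (\<Sum>k<n. (sgn (d k) * U $$ (i,k))\<^sup>2)"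
        using orthogonal_sum_squares[of n "\<lambda>k j. U $$ (j,k)" "\<lambda>k. sgn (d k) * U $$ (i,k)"] A1 by simp
      also have "\<dots> \<le> (\<Sum>k<n. U $$ (i,k) * U $$ (i,k))"
        by (intro sum_mono) (auto simp: sgn_if power2_eq_square)
      finally show ?thesis using A2[OF i i] by simp
    qed
    then have "(\<Sum>i<n. \<Sum>j<n. (S i j)\<^sup>2) \<le> (\<Sum>i<n. 1)" by (intro sum_mono) auto
    then show ?thesis by simp
  qed
  have S1: "\<bar>\<Sum>i<n. \<Sum>j<n. S i j\<bar> \<le> real n"
  proof -
    have "(\<Sum>i<n. \<Sum>j<n. S i j) = (\<Sum>i<n. \<Sum>k<n. \<Sum>j<n. sgn (d k) * (U $$ (i,k) * U $$ (j,k)))"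
      unfolding S_def by (rule sum.cong[OF refl], subst sum.swap) simp
    also have "\<dots> = (\<Sum>k<n. \<Sum>i<n. \<Sum>j<n. sgn (d k) * (U $$ (i,k) * U $$ (j,k)))"
      by (subst sum.swap) simp
    also have "\<dots> = (\<Sum>k<n. sgn (d k) * (\<Sum>i<n. 1 * U $$ (i,k))\<^sup>2)"
      by (simp only: power2_eq_square sum_product mult_1) (simp only: sum_distrib_left)
    finally have "\<bar>\<Sum>i<n. \<Sum>j<n. S i j\<bar> \<le> (\<Sum>k<n. \<bar>sgn (d k) * (\<Sum>i<n. 1 * U $$ (i,k))\<^sup>2\<bar>)"
      by (simp only: sum_abs)
    also have "\<dots> \<le> (\<Sum>k<n. (\<Sum>i<n. 1 * U $$ (i,k))\<^sup>2)"
      by (intro sum_mono) (auto simp: abs_mult sgn_if)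
    also have "\<dots> = real n" using orthogonal_sum_squares[OF A2, of "\<lambda>_. 1"] by simp
    finally show ?thesis .
  qed
  have "energy A = (\<Sum>i<n. \<Sum>j<n. B $$ (i,j) * S i j + (A $$ (i,j) - B $$ (i,j) - c) * S i j + c * S i j)"
    unfolding energy_spectral_decomposition[OF dA] trA[symmetric]
    by (intro sum.cong refl) (simp add: algebra_simps)
  also have "\<dots> \<le> (\<Sum>i<n. \<Sum>j<n. B $$ (i,j) * S i j + ((A $$ (i,j) - B $$ (i,j) - c)\<^sup>2 + (S i j)\<^sup>2) / 2 + c * S i j)"
  proof (intro sum_mono add_mono order_refl)
    fix i j
    have "x * y \<le> (x\<^sup>2 + y\<^sup>2) / 2" for x y :: real
      using sum_squares_bound[of x y] by simp
    then show "(A $$ (i,j) - B $$ (i,j) - c) * S i j \<le> ((A $$ (i,j) - B $$ (i,j) - c)\<^sup>2 + (S i j)\<^sup>2) / 2" .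
  qed
  also have "\<dots> = (\<Sum>i<n. \<Sum>j<n. B $$ (i,j) * S i j)
      + ((\<Sum>i<n. \<Sum>j<n. (A $$ (i,j) - B $$ (i,j) - c)\<^sup>2) + (\<Sum>i<n. \<Sum>j<n. (S i j)\<^sup>2)) / 2
      + c * (\<Sum>i<n. \<Sum>j<n. S i j)"
    by (simp add: sum.distrib sum_distrib_left sum_divide_distrib add_divide_distrib)
  also have "\<dots> \<le> energy B + ((\<Sum>i<n. \<Sum>j<n. (A $$ (i,j) - B $$ (i,j) - c)\<^sup>2) + real n) / 2 + \<bar>c\<bar> * real n"
  proof (intro add_mono divide_right_mono)
    show "(\<Sum>i<n. \<Sum>j<n. B $$ (i,j) * S i j) \<le> energy B"
      unfolding energy_spectral_decomposition[OF dB] by (rule trB)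
    have "c * (\<Sum>i<n. \<Sum>j<n. S i j) \<le> \<bar>c\<bar> * \<bar>\<Sum>i<n. \<Sum>j<n. S i j\<bar>"
      by (metis abs_ge_self abs_mult)
    also have "\<dots> \<le> \<bar>c\<bar> * real n" using S1 by (intro mult_left_mono) auto
    finally show "c * (\<Sum>i<n. \<Sum>j<n. S i j) \<le> \<bar>c\<bar> * real n" .
  qed (use S2 in auto)
  finally show ?thesis .
qed

section \<open>Resolvents on the imaginary axis\<close>

text \<open>
  Entries of \<open>(X - \<i> t)\<^bsup>-1\<^esup>\<close> for a real symmetric \<open>n \<times> n\<close> matrix \<open>X\<close>. They are defined from a spectral decomposition,
  which gives the symmetry and all the norm bounds at once; the inverse does not depend on the
  decomposition chosen, by \<open>resolvent_left_inverse\<close>.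
\<close>

definition resolvent :: "nat \<Rightarrow> real mat \<Rightarrow> real \<Rightarrow> nat \<Rightarrow> nat \<Rightarrow> complex" where
  "resolvent n X t i j =
     (let (U, d) = (SOME (U, d). spectral_decomposition n X U d)
      in \<Sum>k<n. of_real (U $$ (i,k) * U $$ (j,k)) / Complex (d k) (- t))"

lemma resolvent_spectral:
  assumes "X \<in> carrier_mat n n" "X\<^sup>T = X"
  obtains U d where "spectral_decomposition n X U d"
    "\<And>i j t. resolvent n X t i j = (\<Sum>k<n. of_real (U $$ (i,k) * U $$ (j,k)) / Complex (d k) (- t))"
proof -
  have "\<exists>p. case p of (U, d) \<Rightarrow> spectral_decomposition n X U d"
    using real_spectral_theorem[OF assms] by auto
  then have "case (SOME (U, d). spectral_decomposition n X U d) of (U, d) \<Rightarrow> spectral_decomposition n X U d"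
    by (rule someI_ex)
  then show ?thesis
    using that unfolding resolvent_def Let_def by (auto split: prod.splits)
qed

lemma resolvent_sym: "resolvent n X t j i = resolvent n X t i j"
  by (simp add: resolvent_def mult.commute)

lemma resolvent_left_inverse:
  assumes X: "X \<in> carrier_mat n n" "X\<^sup>T = X" and t: "t > 0" and ij: "i < n" "j < n"
  shows "(\<Sum>k<n. (of_real (X $$ (i,k)) - (if i = k then \<i> * of_real t else 0)) * resolvent n X t k j)
       = (if i = j then 1 else 0)"
proof -
  obtain U d where D: "spectral_decomposition n X U d"
    and G: "\<And>i j t. resolvent n X t i j = (\<Sum>k<n. of_real (U $$ (i,k) * U $$ (j,k)) / Complex (d k) (- t))"
    by (rule resolvent_spectral[OF X]) blast
  note C = orthonormal_columns[OF D] and R = orthonormal_rows[OF D] and E = spectral_entry[OF D]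
  have S: "of_real (X $$ (i,k)) - (if i = k then \<i> * of_real t else 0)
      = (\<Sum>l<n. Complex (d l) (- t) * of_real (U $$ (i,l) * U $$ (k,l)))" if k: "k < n" for k
  proof -
    have "(\<Sum>l<n. Complex (d l) (- t) * of_real (U $$ (i,l) * U $$ (k,l)))
       = of_real (\<Sum>l<n. d l * (U $$ (i,l) * U $$ (k,l))) - \<i> * of_real t * of_real (\<Sum>l<n. U $$ (i,l) * U $$ (k,l))"
      by (simp add: Complex_eq sum_distrib_left algebra_simps sum_subtractf)
    then show ?thesis using R[OF ij(1) k] E[OF ij(1) k] by simp
  qed
  have nz: "Complex (d l) (- t) \<noteq> 0" for l using t by (simp add: complex_eq_iff)
  have "(\<Sum>k<n. (of_real (X $$ (i,k)) - (if i = k then \<i> * of_real t else 0)) * resolvent n X t k j)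
    = (\<Sum>k<n. \<Sum>l<n. \<Sum>m<n. Complex (d l) (- t) / Complex (d m) (- t) * of_real (U $$ (i,l) * U $$ (j,m)) * of_real (U $$ (k,l) * U $$ (k,m)))"
    by (intro sum.cong refl) (simp add: S G sum_product mult_ac)
  also have "\<dots> = (\<Sum>l<n. \<Sum>m<n. \<Sum>k<n. Complex (d l) (- t) / Complex (d m) (- t) * of_real (U $$ (i,l) * U $$ (j,m)) * of_real (U $$ (k,l) * U $$ (k,m)))"
    by (subst sum.swap, rule sum.cong[OF refl], subst sum.swap) simp
  also have "\<dots> = (\<Sum>l<n. \<Sum>m<n. Complex (d l) (- t) / Complex (d m) (- t) * of_real (U $$ (i,l) * U $$ (j,m)) * of_real (\<Sum>k<n. U $$ (k,l) * U $$ (k,m)))"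
    by (simp only: sum_distrib_left of_real_sum)
  also have "\<dots> = (\<Sum>l<n. \<Sum>m<n. if l = m then of_real (U $$ (i,l) * U $$ (j,m)) else 0)"
    by (intro sum.cong refl) (simp add: C nz)
  also have "\<dots> = of_real (\<Sum>l<n. U $$ (i,l) * U $$ (j,l))" by simp
  finally show ?thesis using R[OF ij] by simp
qed

lemma resolvent_right_inverse:
  assumes X: "X \<in> carrier_mat n n" "X\<^sup>T = X" and t: "t > 0" and ij: "i < n" "j < n"
  shows "(\<Sum>k<n. resolvent n X t i k * (of_real (X $$ (k,j)) - (if k = j then \<i> * of_real t else 0)))
       = (if i = j then 1 else 0)"
proof -
  have "X $$ (k,j) = X $$ (j,k)" if "k < n" for k
    using X ij that by (metis carrier_matD index_transpose_mat(1))
  then have "(\<Sum>k<n. resolvent n X t i k * (of_real (X $$ (k,j)) - (if k = j then \<i> * of_real t else 0)))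
     = (\<Sum>k<n. (of_real (X $$ (j,k)) - (if j = k then \<i> * of_real t else 0)) * resolvent n X t k i)"
    by (intro sum.cong refl) (auto simp: resolvent_sym[of n X t i])
  also have "\<dots> = (if i = j then 1 else 0)"
    using resolvent_left_inverse[OF X t ij(2,1)] by auto
  finally show ?thesis .
qed

text \<open>
  A row of the resolvent is the image under an orthogonal matrix of a row of \<open>U\<close> whose entries are
  multiplied by \<open>1 / (d\<^sub>k - \<i> t)\<close>, of modulus at most \<open>1 / t\<close>.
\<close>

lemma resolvent_row_norm:
  assumes X: "X \<in> carrier_mat n n" "X\<^sup>T = X" and t: "t > 0" and i: "i < n"
  shows "(\<Sum>j<n. (cmod (resolvent n X t i j))\<^sup>2) \<le> 1 / t\<^sup>2"
proof -
  obtain U d where D: "spectral_decomposition n X U d"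
    and G: "\<And>i j t. resolvent n X t i j = (\<Sum>k<n. of_real (U $$ (i,k) * U $$ (j,k)) / Complex (d k) (- t))"
    by (rule resolvent_spectral[OF X]) blast
  note C = orthonormal_columns[OF D] and R = orthonormal_rows[OF D]
  define g where "g k = inverse (Complex (d k) (- t))" for k
  have gn: "(Re (g k))\<^sup>2 + (Im (g k))\<^sup>2 \<le> 1 / t\<^sup>2" for k
  proof -
    have "(Re (g k))\<^sup>2 + (Im (g k))\<^sup>2 = (cmod (g k))\<^sup>2" by (simp add: cmod_power2)
    also have "\<dots> = 1 / ((d k)\<^sup>2 + t\<^sup>2)"
      by (simp add: g_def norm_inverse power_inverse cmod_power2 divide_inverse)
    also have "\<dots> \<le> 1 / t\<^sup>2" using t by (intro divide_left_mono) (auto intro!: mult_pos_pos add_nonneg_pos)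
    finally show ?thesis .
  qed
  have Gre: "Re (resolvent n X t i j) = (\<Sum>k<n. (U $$ (i,k) * Re (g k)) * U $$ (j,k))"
    and Gim: "Im (resolvent n X t i j) = (\<Sum>k<n. (U $$ (i,k) * Im (g k)) * U $$ (j,k))" for j
    by (simp_all add: G g_def divide_inverse mult_ac)
  have "(\<Sum>j<n. (cmod (resolvent n X t i j))\<^sup>2)
      = (\<Sum>j<n. (\<Sum>k<n. (U $$ (i,k) * Re (g k)) * U $$ (j,k))\<^sup>2) + (\<Sum>j<n. (\<Sum>k<n. (U $$ (i,k) * Im (g k)) * U $$ (j,k))\<^sup>2)"
    by (simp add: cmod_power2 Gre Gim sum.distrib)
  also have "\<dots> = (\<Sum>k<n. (U $$ (i,k) * Re (g k))\<^sup>2) + (\<Sum>k<n. (U $$ (i,k) * Im (g k))\<^sup>2)"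
    using orthogonal_sum_squares[of n "\<lambda>k j. U $$ (j,k)"] C by simp
  also have "\<dots> = (\<Sum>k<n. (U $$ (i,k) * U $$ (i,k)) * ((Re (g k))\<^sup>2 + (Im (g k))\<^sup>2))"
    by (simp add: sum.distrib[symmetric] power2_eq_square algebra_simps)
  also have "\<dots> \<le> (\<Sum>k<n. (U $$ (i,k) * U $$ (i,k)) * (1 / t\<^sup>2))"
    by (intro sum_mono mult_left_mono gn) auto
  also have "\<dots> = 1 / t\<^sup>2" unfolding sum_distrib_right[symmetric] using R[OF i i] by simp
  finally show ?thesis .
qed

lemma resolvent_entry_norm:
  assumes X: "X \<in> carrier_mat n n" "X\<^sup>T = X" and t: "t > 0" and "i < n" "j < n"
  shows "cmod (resolvent n X t i j) \<le> 1 / t"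
proof -
  have "(cmod (resolvent n X t i j))\<^sup>2 \<le> (\<Sum>j<n. (cmod (resolvent n X t i j))\<^sup>2)"
    using assms by (intro member_le_sum) auto
  also have "\<dots> \<le> (1 / t)\<^sup>2" using resolvent_row_norm[OF X t \<open>i < n\<close>] by (simp add: power_divide)
  finally show ?thesis by (rule power2_le_imp_le) (use t in simp)
qed

lemma resolvent_trace:
  assumes X: "X \<in> carrier_mat n n" "X\<^sup>T = X"
  obtains U d where "spectral_decomposition n X U d"
    "\<And>t. Im (\<Sum>i<n. resolvent n X t i i) = (\<Sum>k<n. t / ((d k)\<^sup>2 + t\<^sup>2))"
proof -
  obtain U d where D: "spectral_decomposition n X U d"
    and G: "\<And>i j t. resolvent n X t i j = (\<Sum>k<n. of_real (U $$ (i,k) * U $$ (j,k)) / Complex (d k) (- t))"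
    by (rule resolvent_spectral[OF X]) blast
  have "Im (\<Sum>i<n. resolvent n X t i i) = (\<Sum>k<n. t / ((d k)\<^sup>2 + t\<^sup>2))" for t
  proof -
    have "(\<Sum>i<n. resolvent n X t i i) = (\<Sum>k<n. of_real (\<Sum>i<n. U $$ (i,k) * U $$ (i,k)) / Complex (d k) (- t))"
      unfolding G by (subst sum.swap) (simp only: of_real_sum sum_divide_distrib)
    also have "\<dots> = (\<Sum>k<n. 1 / Complex (d k) (- t))"
      by (intro sum.cong refl) (simp add: orthonormal_columns[OF D])
    finally show ?thesis by (simp add: Im_divide)
  qed
  with D show ?thesis using that by blast
qed

text \<open>
  The second resolvent identity \<open>G - H = G (Y - X) H\<close>.
\<close>

lemma resolvent_identity:
  assumes X: "X \<in> carrier_mat n n" "X\<^sup>T = X" and Y: "Y \<in> carrier_mat n n" "Y\<^sup>T = Y" and t: "t > 0"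
    and ab: "a < n" "b < n"
  shows "resolvent n X t a b - resolvent n Y t a b =
    (\<Sum>i<n. \<Sum>j<n. resolvent n X t a i * of_real (Y $$ (i,j) - X $$ (i,j)) * resolvent n Y t j b)"
proof -
  let ?G = "resolvent n X t" and ?H = "resolvent n Y t"
  let ?M = "\<lambda>Z i j. of_real (Z $$ (i,j)) - (if i = j then \<i> * of_real t else 0)"
  have "(\<Sum>i<n. \<Sum>j<n. ?G a i * of_real (Y $$ (i,j) - X $$ (i,j)) * ?H j b)
     = (\<Sum>i<n. \<Sum>j<n. ?G a i * ?M Y i j * ?H j b) - (\<Sum>i<n. \<Sum>j<n. ?G a i * ?M X i j * ?H j b)"
    unfolding sum_subtractf[symmetric] by (intro sum.cong refl) (simp add: algebra_simps)
  also have "(\<Sum>i<n. \<Sum>j<n. ?G a i * ?M Y i j * ?H j b) = (\<Sum>i<n. ?G a i * (\<Sum>j<n. ?M Y i j * ?H j b))"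
    by (simp only: sum_distrib_left mult.assoc)
  also have "\<dots> = (\<Sum>i<n. ?G a i * (if i = b then 1 else 0))"
    using resolvent_left_inverse[OF Y t _ ab(2)] by (intro sum.cong refl) auto
  also have "\<dots> = (\<Sum>i<n. if i = b then ?G a i else 0)" by (intro sum.cong refl) simp
  also have "\<dots> = ?G a b" using ab by simp
  also have "(\<Sum>i<n. \<Sum>j<n. ?G a i * ?M X i j * ?H j b) = (\<Sum>j<n. (\<Sum>i<n. ?G a i * ?M X i j) * ?H j b)"
    by (subst sum.swap) (simp only: sum_distrib_right)
  also have "\<dots> = (\<Sum>j<n. (if a = j then 1 else 0) * ?H j b)"
    using resolvent_right_inverse[OF X t ab(1)] by (intro sum.cong refl) auto
  also have "\<dots> = (\<Sum>j<n. if a = j then ?H j b else 0)" by (intro sum.cong refl) simp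
  also have "\<dots> = ?H a b" using ab by simp
  finally show ?thesis ..
qed

text \<open>
  Adding or removing one edge changes a symmetric pair of entries. The identity is exact, so that no
  differentiability of the resolvent in the matrix entries enters.
\<close>

lemma resolvent_two_entries:
  assumes X: "X \<in> carrier_mat n n" "X\<^sup>T = X" and Y: "Y \<in> carrier_mat n n" "Y\<^sup>T = Y" and t: "t > 0"
    and ij: "i < n" "j < n" "i \<noteq> j" and ab: "a < n" "b < n"
    and diff: "\<And>k l. k < n \<Longrightarrow> l < n \<Longrightarrow> Y $$ (k,l) - X $$ (k,l) = (if {k,l} = {i,j} then h else 0)"
  shows "resolvent n X t a b - resolvent n Y t a b =
     of_real h * (resolvent n X t a i * resolvent n Y t j b + resolvent n X t a j * resolvent n Y t i b)"
proof -
  let ?G = "resolvent n X t" and ?H = "resolvent n Y t"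
  have "?G a b - ?H a b = (\<Sum>k<n. \<Sum>l<n. ?G a k * of_real (Y $$ (k,l) - X $$ (k,l)) * ?H l b)"
    by (rule resolvent_identity[OF X Y t ab])
  also have "\<dots> = (\<Sum>k<n. \<Sum>l<n. (if l = j then if k = i then of_real h * (?G a k * ?H l b) else 0 else 0)
       + (if l = i then if k = j then of_real h * (?G a k * ?H l b) else 0 else 0))"
    by (intro sum.cong refl) (use ij in \<open>auto simp: diff doubleton_eq_iff\<close>)
  also have "\<dots> = (\<Sum>k<n. (if k = i then of_real h * (?G a k * ?H j b) else 0)
       + (if k = j then of_real h * (?G a k * ?H i b) else 0))"
    by (intro sum.cong refl) (use ij in \<open>simp add: sum.distrib\<close>)
  also have "\<dots> = of_real h * (?G a i * ?H j b + ?G a j * ?H i b)"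
    using ij by (simp add: sum.distrib algebra_simps)
  finally show ?thesis .
qed

text \<open>
  For the trace the bound is the same as for one entry, with no factor \<open>n\<close>: the sum over the diagonal is an
  inner product of a row of one resolvent with a row of the other. This gain makes the
  variance of the normalised trace small.
\<close>

lemma resolvent_two_entries_norm:
  assumes X: "X \<in> carrier_mat n n" "X\<^sup>T = X" and Y: "Y \<in> carrier_mat n n" "Y\<^sup>T = Y" and t: "t > 0"
    and ij: "i < n" "j < n" "i \<noteq> j"
    and diff: "\<And>k l. k < n \<Longrightarrow> l < n \<Longrightarrow> Y $$ (k,l) - X $$ (k,l) = (if {k,l} = {i,j} then h else 0)"
  shows resolvent_entry_lipschitz:
      "\<And>a b. a < n \<Longrightarrow> b < n \<Longrightarrow> cmod (resolvent n X t a b - resolvent n Y t a b) \<le> 2 * \<bar>h\<bar> / t\<^sup>2"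
    and resolvent_trace_lipschitz:
      "cmod ((\<Sum>a<n. resolvent n X t a a) - (\<Sum>a<n. resolvent n Y t a a)) \<le> 2 * \<bar>h\<bar> / t\<^sup>2"
proof -
  let ?G = "resolvent n X t" and ?H = "resolvent n Y t"
  note eq = resolvent_two_entries[OF X Y t ij _ _ diff]
  note Gb = resolvent_entry_norm[OF X t] and Hb = resolvent_entry_norm[OF Y t]
  show "cmod (?G a b - ?H a b) \<le> 2 * \<bar>h\<bar> / t\<^sup>2" if "a < n" "b < n" for a b
  proof -
    have "cmod (?G a b - ?H a b) = \<bar>h\<bar> * cmod (?G a i * ?H j b + ?G a j * ?H i b)"
      by (subst eq[OF that]) (auto simp: norm_mult)
    also have "\<dots> \<le> \<bar>h\<bar> * (cmod (?G a i) * cmod (?H j b) + cmod (?G a j) * cmod (?H i b))"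
      by (intro mult_left_mono order.trans[OF norm_triangle_ineq]) (auto simp: norm_mult)
    also have "\<dots> \<le> \<bar>h\<bar> * (1 / t * (1 / t) + 1 / t * (1 / t))"
      using that ij t by (intro mult_left_mono add_mono mult_mono Gb Hb) auto
    finally show ?thesis by (simp add: power2_eq_square mult.commute)
  qed
  have prod: "(\<Sum>a<n. cmod (?G a k) * cmod (?H l a)) \<le> 1 / t\<^sup>2" if "k < n" "l < n" for k l
  proof -
    have "(\<Sum>a<n. cmod (?G a k) * cmod (?H l a)) \<le> (\<Sum>a<n. ((cmod (?G k a))\<^sup>2 + (cmod (?H l a))\<^sup>2) / 2)"
    proof (intro sum_mono)
      fix a
      show "cmod (?G a k) * cmod (?H l a) \<le> ((cmod (?G k a))\<^sup>2 + (cmod (?H l a))\<^sup>2) / 2"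
        unfolding resolvent_sym[of n X t a k]
        using sum_squares_bound[of "cmod (?G k a)" "cmod (?H l a)"] by simp
    qed
    also have "\<dots> = ((\<Sum>a<n. (cmod (?G k a))\<^sup>2) + (\<Sum>a<n. (cmod (?H l a))\<^sup>2)) / 2"
      by (simp add: sum.distrib sum_divide_distrib[symmetric])
    also have "\<dots> \<le> (1 / t\<^sup>2 + 1 / t\<^sup>2) / 2"
      using that by (intro divide_right_mono add_mono resolvent_row_norm[OF X t] resolvent_row_norm[OF Y t]) auto
    finally show ?thesis by simp
  qed
  have tr: "(\<Sum>a<n. ?G a a) - (\<Sum>a<n. ?H a a) = (\<Sum>a<n. of_real h * (?G a i * ?H j a + ?G a j * ?H i a))"
    unfolding sum_subtractf[symmetric] by (intro sum.cong refl eq) auto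
  have "cmod ((\<Sum>a<n. ?G a a) - (\<Sum>a<n. ?H a a)) \<le> (\<Sum>a<n. \<bar>h\<bar> * (cmod (?G a i) * cmod (?H j a) + cmod (?G a j) * cmod (?H i a)))"
    unfolding tr
  proof (rule sum_norm_le)
    fix a
    have "cmod (?G a i * ?H j a + ?G a j * ?H i a) \<le> cmod (?G a i) * cmod (?H j a) + cmod (?G a j) * cmod (?H i a)"
      using norm_triangle_ineq[of "?G a i * ?H j a" "?G a j * ?H i a"] by (simp add: norm_mult)
    then show "cmod (of_real h * (?G a i * ?H j a + ?G a j * ?H i a))
        \<le> \<bar>h\<bar> * (cmod (?G a i) * cmod (?H j a) + cmod (?G a j) * cmod (?H i a))"
      unfolding norm_mult[of "of_real h"] norm_of_real by (rule mult_left_mono) simp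
  qed
  also have "\<dots> = \<bar>h\<bar> * ((\<Sum>a<n. cmod (?G a i) * cmod (?H j a)) + (\<Sum>a<n. cmod (?G a j) * cmod (?H i a)))"
    by (subst sum.distrib[symmetric], subst sum_distrib_left, rule refl)
  also have "\<dots> \<le> \<bar>h\<bar> * (1 / t\<^sup>2 + 1 / t\<^sup>2)"
    by (rule mult_left_mono[OF add_mono[OF prod[OF ij(1,2)] prod[OF ij(2,1)]] abs_ge_zero])
  also have "\<dots> = 2 * \<bar>h\<bar> / t\<^sup>2" by (simp add: algebra_simps)
  finally show "cmod ((\<Sum>a<n. ?G a a) - (\<Sum>a<n. ?H a a)) \<le> 2 * \<bar>h\<bar> / t\<^sup>2" .
qed

section \<open>Functions of independent Bernoulli variables\<close>

lemma integrable_Pi_bernoulli [simp]: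
  fixes F :: "('i \<Rightarrow> bool) \<Rightarrow> 'b::{banach, second_countable_topology}"
  assumes "finite I"
  shows "integrable (measure_pmf (Pi_pmf I d (\<lambda>_. bernoulli_pmf p))) F"
proof (rule integrable_measure_pmf_finite)
  have "set_pmf (Pi_pmf I d (\<lambda>_. bernoulli_pmf p)) \<subseteq> PiE_dflt I d (\<lambda>_. UNIV)"
    using set_Pi_pmf_subset[OF assms, of d "\<lambda>_. bernoulli_pmf p"] by (auto simp: PiE_dflt_def)
  moreover have "finite (PiE_dflt I d (\<lambda>_. UNIV :: bool set))"
    using assms by (intro finite_PiE_dflt) auto
  ultimately show "finite (set_pmf (Pi_pmf I d (\<lambda>_. bernoulli_pmf p)))" by (rule finite_subset)
qed

context
  fixes p :: real
  assumes p: "0 \<le> p" "p \<le> 1"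
begin

abbreviation bernoulli_product :: "'i set \<Rightarrow> ('i \<Rightarrow> bool) pmf" where
  "bernoulli_product I \<equiv> Pi_pmf I False (\<lambda>_. bernoulli_pmf p)"

lemma expectation_insert_coordinate:
  fixes F :: "('i \<Rightarrow> bool) \<Rightarrow> 'b::{banach, second_countable_topology}"
  assumes "finite A" "x \<notin> A"
  shows "measure_pmf.expectation (bernoulli_product (insert x A)) F =
    measure_pmf.expectation (bernoulli_product A)
      (\<lambda>w. p *\<^sub>R F (w(x := True)) + (1 - p) *\<^sub>R F (w(x := False)))"
proof -
  let ?E = "measure_pmf.expectation (bernoulli_product A)"
  have fin: "finite (set_pmf (bernoulli_product A))"
    by (rule finite_subset[OF set_Pi_pmf_subset'[OF assms(1)] finite_PiE_dflt[OF assms(1)]]) auto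
  have "measure_pmf.expectation (bernoulli_product (insert x A)) F =
      (\<Sum>y\<in>UNIV. pmf (bernoulli_pmf p) y *\<^sub>R
         measure_pmf.expectation (map_pmf (\<lambda>w. w(x := y)) (bernoulli_product A)) F)"
    unfolding Pi_pmf_insert'[OF assms] map_pmf_def[symmetric]
    by (rule pmf_expectation_bind) (auto simp: fin)
  also have "\<dots> = p *\<^sub>R ?E (\<lambda>w. F (w(x := True))) + (1 - p) *\<^sub>R ?E (\<lambda>w. F (w(x := False)))"
    using p by (simp add: UNIV_bool)
  also have "\<dots> = ?E (\<lambda>w. p *\<^sub>R F (w(x := True)) + (1 - p) *\<^sub>R F (w(x := False)))"
    using assms by simp
  finally show ?thesis .
qed

lemma expectation_resample_coordinate:
  fixes F :: "('i \<Rightarrow> bool) \<Rightarrow> 'b::{banach, second_countable_topology}"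
  assumes "finite I" "e \<in> I"
  shows "measure_pmf.expectation (bernoulli_product I) F =
    measure_pmf.expectation (bernoulli_product I)
      (\<lambda>w. p *\<^sub>R F (w(e := True)) + (1 - p) *\<^sub>R F (w(e := False)))"
proof -
  have I: "I = insert e (I - {e})" and "finite (I - {e})" "e \<notin> I - {e}" using assms by auto
  note ins = expectation_insert_coordinate[OF this(2,3)]
  show ?thesis
    by (subst (1 2) I, subst (1 2) ins) (simp add: scaleR_add_left[symmetric])
qed

text \<open>
  The discrete analogue of Gaussian integration by parts. A function of one bit is affine, so there is
  no remainder.
\<close>

lemma bernoulli_integration_by_parts:
  fixes F :: "('i \<Rightarrow> bool) \<Rightarrow> 'b::{banach, second_countable_topology}"
  assumes "finite I" "e \<in> I"
  shows "measure_pmf.expectation (bernoulli_product I) (\<lambda>w. (of_bool (w e) - p) *\<^sub>R F w) =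
    (p * (1 - p)) *\<^sub>R measure_pmf.expectation (bernoulli_product I)
      (\<lambda>w. F (w(e := True)) - F (w(e := False)))"
  by (subst expectation_resample_coordinate[OF assms])
    (simp add: assms integral_scaleR_right[symmetric] scaleR_diff_right algebra_simps
      del: integral_scaleR_right integral_diff Bochner_Integration.integral_diff)

text \<open>
  Integrating out one coordinate \<open>x\<close> replaces \<open>F\<close> by its conditional mean \<open>F1\<close>, which has the same bounded
  differences in the other coordinates, and loses the conditional variance
  \<open>p (1 - p) (F(x = 1) - F(x = 0))\<^sup>2\<close>.
\<close>

theorem Efron_Stein_bounded_differences:
  fixes F :: "('i \<Rightarrow> bool) \<Rightarrow> real"
  assumes "finite I"
    and "\<And>w e. e \<in> I \<Longrightarrow> \<bar>F (w(e := True)) - F (w(e := False))\<bar> \<le> c e"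
  defines "E \<equiv> measure_pmf.expectation (bernoulli_product I)"
  shows "E (\<lambda>w. (F w - E F)\<^sup>2) \<le> p * (1 - p) * (\<Sum>e\<in>I. (c e)\<^sup>2)"
proof -
  have "measure_pmf.expectation (bernoulli_product I) (\<lambda>w. (F w)\<^sup>2)
      - (measure_pmf.expectation (bernoulli_product I) F)\<^sup>2 \<le> p * (1 - p) * (\<Sum>e\<in>I. (c e)\<^sup>2)"
    using assms(1,2)
  proof (induction I arbitrary: F rule: finite_induct)
    case empty
    then show ?case by simp
  next
    case (insert x A)
    let ?E = "measure_pmf.expectation (bernoulli_product A)"
    define F1 where "F1 w = p * F (w(x := True)) + (1 - p) * F (w(x := False))" for w
    have F1_diff: "\<bar>F1 (w(e := True)) - F1 (w(e := False))\<bar> \<le> c e" if e: "e \<in> A" for w e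
    proof -
      have ne: "x \<noteq> e" using e insert.hyps by auto
      have eq: "F1 (w(e := True)) - F1 (w(e := False)) =
          p * (F (w(x := True, e := True)) - F (w(x := True, e := False))) +
          (1 - p) * (F (w(x := False, e := True)) - F (w(x := False, e := False)))"
        by (simp add: F1_def fun_upd_twist[OF ne] algebra_simps)
      have "\<bar>F1 (w(e := True)) - F1 (w(e := False))\<bar> \<le> p * \<bar>F (w(x := True, e := True)) - F (w(x := True, e := False))\<bar> +
          (1 - p) * \<bar>F (w(x := False, e := True)) - F (w(x := False, e := False))\<bar>"
        unfolding eq using p by (intro order.trans[OF abs_triangle_ineq]) (simp add: abs_mult)
      also have "\<dots> \<le> p * c e + (1 - p) * c e"
        using p e by (intro add_mono mult_left_mono insert.prems) auto
      finally show ?thesis by (simp add: algebra_simps)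
    qed
    have id: "p * (F (w(x := True)))\<^sup>2 + (1 - p) * (F (w(x := False)))\<^sup>2 =
        (F1 w)\<^sup>2 + p * (1 - p) * (F (w(x := True)) - F (w(x := False)))\<^sup>2" for w
      by (simp add: F1_def power2_eq_square algebra_simps)
    have "?E (\<lambda>w. (F1 w)\<^sup>2 + p * (1 - p) * (F (w(x := True)) - F (w(x := False)))\<^sup>2)
        \<le> ?E (\<lambda>w. (F1 w)\<^sup>2 + p * (1 - p) * (c x)\<^sup>2)"
    proof (rule integral_mono)
      fix w
      have "\<bar>F (w(x := True)) - F (w(x := False))\<bar> \<le> \<bar>c x\<bar>"
        by (rule order.trans[OF insert.prems abs_ge_self]) simp
      then have "(F (w(x := True)) - F (w(x := False)))\<^sup>2 \<le> (c x)\<^sup>2"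
        by (simp add: abs_le_square_iff)
      then show "(F1 w)\<^sup>2 + p * (1 - p) * (F (w(x := True)) - F (w(x := False)))\<^sup>2
          \<le> (F1 w)\<^sup>2 + p * (1 - p) * (c x)\<^sup>2"
        using p by (intro add_left_mono mult_left_mono) auto
    qed (use insert.hyps in auto)
    also have "\<dots> = ?E (\<lambda>w. (F1 w)\<^sup>2) + p * (1 - p) * (c x)\<^sup>2"
      using insert.hyps by simp
    finally have "measure_pmf.expectation (bernoulli_product (insert x A)) (\<lambda>w. (F w)\<^sup>2)
        \<le> ?E (\<lambda>w. (F1 w)\<^sup>2) + p * (1 - p) * (c x)\<^sup>2"
      by (simp only: expectation_insert_coordinate[OF insert.hyps] real_scaleR_def id)
    moreover have "measure_pmf.expectation (bernoulli_product (insert x A)) F = ?E F1"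
      unfolding expectation_insert_coordinate[OF insert.hyps] by (simp add: F1_def[abs_def])
    moreover have "?E (\<lambda>w. (F1 w)\<^sup>2) - (?E F1)\<^sup>2 \<le> p * (1 - p) * (\<Sum>e\<in>A. (c e)\<^sup>2)"
      by (rule insert.IH) (rule F1_diff)
    ultimately show ?case using insert.hyps by (simp add: distrib_left)
  qed
  moreover have "E (\<lambda>w. (F w - E F)\<^sup>2) = E (\<lambda>w. (F w)\<^sup>2) - (E F)\<^sup>2"
  proof -
    have "E (\<lambda>w. (F w - E F)\<^sup>2) = E (\<lambda>w. (F w)\<^sup>2 - 2 * E F * F w + (E F)\<^sup>2)"
      by (simp add: power2_diff algebra_simps)
    also have "\<dots> = E (\<lambda>w. (F w)\<^sup>2) - 2 * E F * E F + (E F)\<^sup>2"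
      unfolding E_def using assms(1) by simp
    finally show ?thesis by (simp add: power2_eq_square)
  qed
  ultimately show ?thesis by (simp add: E_def)
qed

end

section \<open>The Stieltjes transform of a Wigner matrix\<close>

lemma finite_vertex_pairs [simp]: "finite (vertex_pairs n)"
  unfolding vertex_pairs_def by (rule finite_subset[of _ "Pow {1..n}"]) auto

lemma card_vertex_pairs_le: "card (vertex_pairs n) \<le> n\<^sup>2"
proof -
  have "card (vertex_pairs n) = n choose 2"
    unfolding vertex_pairs_def using n_subsets[of "{1..n}" 2] by simp
  also have "\<dots> = n * (n - 1) div 2" by (rule choose_two)
  also have "\<dots> \<le> n * (n - 1)" by simp
  also have "\<dots> \<le> n\<^sup>2" by (simp add: power2_eq_square)
  finally show ?thesis .
qed

lemma vertex_pairsE: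
  assumes "e \<in> vertex_pairs n"
  obtains i j where "i < n" "j < n" "i \<noteq> j" "e = {Suc i, Suc j}"
proof -
  from assms obtain x y where xy: "e = {x, y}" "x \<noteq> y" "e \<subseteq> {1..n}"
    unfolding vertex_pairs_def by (auto simp: card_2_iff)
  then show ?thesis using that[of "x - 1" "y - 1"] by auto
qed

lemma vertex_pairsI: "i < n \<Longrightarrow> j < n \<Longrightarrow> i \<noteq> j \<Longrightarrow> {Suc i, Suc j} \<in> vertex_pairs n"
  unfolding vertex_pairs_def by auto

text \<open>
  The centred adjacency matrix divided by \<open>sqrt n\<close>, as a function of the edge indicator \<open>w\<close>.
\<close>

definition wigner :: "nat \<Rightarrow> real \<Rightarrow> (nat set \<Rightarrow> bool) \<Rightarrow> real mat" where
  "wigner n p w = mat n n (\<lambda>(i, j). if i = j then 0 else (of_bool (w {Suc i, Suc j}) - p) / sqrt (real n))"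

lemma wigner_carrier [simp]: "wigner n p w \<in> carrier_mat n n"
  by (simp add: wigner_def)

lemma wigner_sym [simp]: "(wigner n p w)\<^sup>T = wigner n p w"
  by (rule eq_matI) (auto simp: wigner_def insert_commute)

lemma wigner_update:
  assumes "i < n" "j < n" "i \<noteq> j" "k < n" "l < n"
  shows "wigner n p (w({Suc i, Suc j} := b)) $$ (k,l) - wigner n p (w({Suc i, Suc j} := b')) $$ (k,l) =
    (if {k,l} = {i,j} then (of_bool b - of_bool b') / sqrt (real n) else 0)"
proof -
  have "{Suc k, Suc l} = {Suc i, Suc j} \<longleftrightarrow> {k,l} = {i,j}" by (auto simp: doubleton_eq_iff)
  then show ?thesis using assms
    by (auto simp: wigner_def diff_divide_distrib[symmetric] doubleton_eq_iff)
qed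

text \<open>
  The Stieltjes transform of the empirical eigenvalue distribution of the Wigner matrix, at the point
  \<open>\<i> t\<close>.
\<close>

definition stieltjes :: "nat \<Rightarrow> real \<Rightarrow> real \<Rightarrow> (nat set \<Rightarrow> bool) \<Rightarrow> complex" where
  "stieltjes n p t w = (\<Sum>a<n. resolvent n (wigner n p w) t a a) / of_nat n"

lemma norm_expectation_le:
  fixes F :: "'a \<Rightarrow> 'b::{banach, second_countable_topology}"
  assumes "\<And>x. norm (F x) \<le> B"
  shows "norm (measure_pmf.expectation M F) \<le> B"
proof -
  have B: "0 \<le> B" using assms[of undefined] norm_ge_zero order.trans by blast
  have "norm (measure_pmf.expectation M F) \<le> measure_pmf.expectation M (\<lambda>x. norm (F x))"
    by (rule integral_norm_bound)
  also have "\<dots> \<le> measure_pmf.expectation M (\<lambda>_. B)"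
    by (rule integral_mono_AE') (use assms B in auto)
  finally show ?thesis by simp
qed

text \<open>
  Since \<open>\<i> m\<close> is an exact root, the quadratic polynomial factors as \<open>(z - \<i> m) (\<i> t + v (z + \<i> m))\<close>. In the upper
  half plane the imaginary part of the second factor is at least \<open>t\<close>.
\<close>

lemma self_consistent_stability:
  fixes z :: complex and t v m :: real
  assumes "t > 0" "v > 0" "m \<ge> 0" "Im z \<ge> 0" and m: "t * m + v * m\<^sup>2 = 1"
  shows "cmod (z - \<i> * of_real m) \<le> cmod (1 + \<i> * of_real t * z + of_real v * z\<^sup>2) / t"
proof -
  let ?f = "\<i> * of_real t + of_real v * (z + \<i> * of_real m)"
  have "(1::complex) = of_real (t * m + v * m\<^sup>2)" unfolding m by simp
  then have eq: "1 + \<i> * of_real t * z + of_real v * z\<^sup>2 = (z - \<i> * of_real m) * ?f"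
    by (simp add: algebra_simps power2_eq_square)
  have "t \<le> t + v * (Im z + m)" using assms by simp
  also have "\<dots> = Im ?f" by simp
  also have "\<dots> \<le> cmod ?f" using abs_Im_le_cmod[of ?f] by linarith
  finally have "cmod (z - \<i> * of_real m) * t \<le> cmod (z - \<i> * of_real m) * cmod ?f"
    by (rule mult_left_mono) simp
  then show ?thesis unfolding eq norm_mult using assms(1) by (simp add: pos_le_divide_eq)
qed

context
  fixes p t :: real and n :: nat
  assumes p: "0 < p" "p < 1" and t: "t > 0" and n: "n > 0"
begin

private abbreviation (input) "s \<equiv> stieltjes n p t"
private abbreviation (input) "G w \<equiv> resolvent n (wigner n p w) t"
private abbreviation (input) "E F \<equiv> measure_pmf.expectation (Pi_pmf (vertex_pairs n) False (\<lambda>_. bernoulli_pmf p)) F"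

private lemma p': "0 \<le> p" "p \<le> 1" using p by auto

lemma Im_stieltjes_nonneg: "0 \<le> Im (s w)"
proof -
  obtain U d where "\<And>t. Im (\<Sum>i<n. resolvent n (wigner n p w) t i i) = (\<Sum>k<n. t / ((d k)\<^sup>2 + t\<^sup>2))"
    using resolvent_trace[OF wigner_carrier wigner_sym] by metis
  then have eq: "Im (s w) = (\<Sum>k<n. t / ((d k)\<^sup>2 + t\<^sup>2)) / real n"
    by (simp add: stieltjes_def)
  show "0 \<le> Im (s w)" unfolding eq using t by (intro divide_nonneg_nonneg sum_nonneg) auto
qed

lemma stieltjes_bounded_difference:
  assumes "e \<in> vertex_pairs n"
  shows "cmod (s (w(e := True)) - s (w(e := False))) \<le> 2 / (real n * sqrt (real n) * t\<^sup>2)"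
proof -
  obtain i j where ij: "i < n" "j < n" "i \<noteq> j" "e = {Suc i, Suc j}"
    using vertex_pairsE[OF assms] by blast
  have "cmod ((\<Sum>a<n. G (w(e := False)) a a) - (\<Sum>a<n. G (w(e := True)) a a)) \<le> 2 * \<bar>1 / sqrt (real n)\<bar> / t\<^sup>2"
    unfolding ij(4)
    by (rule resolvent_trace_lipschitz[OF wigner_carrier wigner_sym wigner_carrier wigner_sym t ij(1-3)])
      (simp add: wigner_update ij)
  then have "cmod ((\<Sum>a<n. G (w(e := True)) a a) - (\<Sum>a<n. G (w(e := False)) a a)) / real n
      \<le> 2 * \<bar>1 / sqrt (real n)\<bar> / t\<^sup>2 / real n"
    by (intro divide_right_mono) (simp_all add: norm_minus_commute)
  then show ?thesis
    unfolding stieltjes_def diff_divide_distrib[symmetric] norm_divide norm_of_nat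
    by (simp add: field_simps)
qed

text \<open>
  There are fewer than \<open>n\<^sup>2\<close> edges, and each of them changes the transform by \<open>O(n\<^bsup>-3/2\<^esup>)\<close>.
\<close>

lemma stieltjes_variance:
  shows "E (\<lambda>w. (Re (s w) - Re (E s))\<^sup>2) \<le> 4 / (real n * t ^ 4)"
    and "E (\<lambda>w. (Im (s w) - Im (E s))\<^sup>2) \<le> 4 / (real n * t ^ 4)"
proof -
  let ?c = "2 / (real n * sqrt (real n) * t\<^sup>2)"
  have bound: "p * (1 - p) * (\<Sum>e\<in>vertex_pairs n. ?c\<^sup>2) \<le> 4 / (real n * t ^ 4)"
  proof -
    have "p * (1 - p) * (\<Sum>e\<in>vertex_pairs n. ?c\<^sup>2) \<le> 1 * ((real n)\<^sup>2 * ?c\<^sup>2)"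
    proof (intro mult_mono)
      show "p * (1 - p) \<le> 1" using p by (intro mult_le_one) auto
      have "real (card (vertex_pairs n)) \<le> (real n)\<^sup>2"
        using card_vertex_pairs_le[of n] by (metis of_nat_le_iff of_nat_power)
      then show "(\<Sum>e\<in>vertex_pairs n. ?c\<^sup>2) \<le> (real n)\<^sup>2 * ?c\<^sup>2"
        by (simp only: sum_constant) (intro mult_right_mono, auto)
    qed (auto intro!: sum_nonneg)
    also have "\<dots> = 4 / (real n * t ^ 4)"
      using n t by (simp add: power_divide power_mult_distrib field_simps power2_eq_square power4_eq_xxxx)
    finally show ?thesis .
  qed
  have Re: "Re (E s) = E (\<lambda>w. Re (s w))" and Im: "Im (E s) = E (\<lambda>w. Im (s w))" by simp_all
  show "E (\<lambda>w. (Re (s w) - Re (E s))\<^sup>2) \<le> 4 / (real n * t ^ 4)"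
    unfolding Re
  proof (rule order.trans[OF Efron_Stein_bounded_differences[OF p' finite_vertex_pairs] bound])
    fix w :: "nat set \<Rightarrow> bool" and e assume "e \<in> vertex_pairs n"
    from stieltjes_bounded_difference[OF this, of w] show "\<bar>Re (s (w(e := True))) - Re (s (w(e := False)))\<bar> \<le> ?c"
      using abs_Re_le_cmod[of "s (w(e := True)) - s (w(e := False))"] by simp
  qed
  show "E (\<lambda>w. (Im (s w) - Im (E s))\<^sup>2) \<le> 4 / (real n * t ^ 4)"
    unfolding Im
  proof (rule order.trans[OF Efron_Stein_bounded_differences[OF p' finite_vertex_pairs] bound])
    fix w :: "nat set \<Rightarrow> bool" and e assume "e \<in> vertex_pairs n"
    from stieltjes_bounded_difference[OF this, of w] show "\<bar>Im (s (w(e := True))) - Im (s (w(e := False)))\<bar> \<le> ?c"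
      using abs_Im_le_cmod[of "s (w(e := True)) - s (w(e := False))"] by simp
  qed
qed

lemma expectation_square_stieltjes: "cmod (E (\<lambda>w. (s w)\<^sup>2) - (E s)\<^sup>2) \<le> 8 / (real n * t ^ 4)"
proof -
  have "E (\<lambda>w. (s w - E s)\<^sup>2) = E (\<lambda>w. (s w)\<^sup>2 - (2 * E s) * s w + (E s)\<^sup>2)"
    by (simp add: power2_diff mult_ac)
  also have "\<dots> = E (\<lambda>w. (s w)\<^sup>2) - (2 * E s) * E s + (E s)\<^sup>2" by simp
  finally have eq: "E (\<lambda>w. (s w)\<^sup>2) - (E s)\<^sup>2 = E (\<lambda>w. (s w - E s)\<^sup>2)"
    by (simp add: power2_eq_square)
  have "cmod (E (\<lambda>w. (s w)\<^sup>2) - (E s)\<^sup>2) \<le> E (\<lambda>w. cmod ((s w - E s)\<^sup>2))"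
    unfolding eq by (rule integral_norm_bound)
  also have "\<dots> = E (\<lambda>w. (Re (s w) - Re (E s))\<^sup>2 + (Im (s w) - Im (E s))\<^sup>2)"
    by (simp add: norm_power cmod_power2)
  also have "\<dots> = E (\<lambda>w. (Re (s w) - Re (E s))\<^sup>2) + E (\<lambda>w. (Im (s w) - Im (E s))\<^sup>2)"
    by simp
  also have "\<dots> \<le> 4 / (real n * t ^ 4) + 4 / (real n * t ^ 4)"
    by (intro add_mono stieltjes_variance)
  finally show ?thesis by simp
qed

lemma stieltjes_trace_identity:
  "1 + \<i> * of_real t * s w =
     (\<Sum>i<n. \<Sum>j<n. of_real (wigner n p w $$ (i,j)) * G w j i) / of_nat n"
proof -
  have "(\<Sum>i<n. \<Sum>j<n. of_real (wigner n p w $$ (i,j)) * G w j i)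
     = (\<Sum>i<n. (\<Sum>j<n. (of_real (wigner n p w $$ (i,j)) - (if i = j then \<i> * of_real t else 0)) * G w j i)
         + \<i> * of_real t * G w i i)"
  proof (intro sum.cong refl)
    fix i assume i: "i \<in> {..<n}"
    have "(\<Sum>j<n. (of_real (wigner n p w $$ (i,j)) - (if i = j then \<i> * of_real t else 0)) * G w j i)
       = (\<Sum>j<n. of_real (wigner n p w $$ (i,j)) * G w j i - (if i = j then \<i> * of_real t * G w j i else 0))"
      by (intro sum.cong refl) (simp add: algebra_simps)
    also have "\<dots> = (\<Sum>j<n. of_real (wigner n p w $$ (i,j)) * G w j i) - \<i> * of_real t * G w i i"
      using i by (simp add: sum_subtractf)
    finally show "(\<Sum>j<n. of_real (wigner n p w $$ (i,j)) * G w j i)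
      = (\<Sum>j<n. (of_real (wigner n p w $$ (i,j)) - (if i = j then \<i> * of_real t else 0)) * G w j i) + \<i> * of_real t * G w i i"
      by simp
  qed
  also have "\<dots> = (\<Sum>i<n. 1 + \<i> * of_real t * G w i i)"
    by (intro sum.cong refl) (simp add: resolvent_left_inverse[OF wigner_carrier wigner_sym t])
  also have "\<dots> = of_nat n + \<i> * of_real t * (\<Sum>i<n. G w i i)"
    by (simp add: sum.distrib sum_distrib_left)
  finally show ?thesis using n by (simp add: stieltjes_def field_simps)
qed

text \<open>
  Integration by parts in the edge \<open>ij\<close> produces the difference of \<open>G\<^sub>j\<^sub>i\<close> with and without this edge, which
  \<open>resolvent_two_entries\<close> turns into a product of the two resolvents. Replacing both by \<open>G\<close> costs
  another factor \<open>1 / sqrt n\<close>.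
\<close>

lemma expectation_entry_times_resolvent:
  assumes ij: "i < n" "j < n" "i \<noteq> j"
  shows "cmod (E (\<lambda>w. of_real (wigner n p w $$ (i,j)) * G w j i)
      + of_real (p * (1 - p) / real n) * E (\<lambda>w. (G w j i)\<^sup>2 + G w j j * G w i i))
    \<le> p * (1 - p) / real n * (8 / (sqrt (real n) * t ^ 3))"
proof -
  let ?e = "{Suc i, Suc j}" and ?h = "1 / sqrt (real n)"
  let ?Q = "\<lambda>w. (G w j i)\<^sup>2 + G w j j * G w i i"
  let ?D = "\<lambda>w. (G (w(?e := True)) j i - G (w(?e := False)) j i) / of_real (sqrt (real n))"
  let ?r = "\<lambda>w. ?D w + ?Q w / of_nat n"
  have e: "?e \<in> vertex_pairs n" using ij by (rule vertex_pairsI)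
  have "E (\<lambda>w. of_real (wigner n p w $$ (i,j)) * G w j i)
      = E (\<lambda>w. (of_bool (w ?e) - p) *\<^sub>R (G w j i / of_real (sqrt (real n))))"
    using ij by (simp add: wigner_def scaleR_conv_of_real)
  also have "\<dots> = (p * (1 - p)) *\<^sub>R E ?D"
    by (subst bernoulli_integration_by_parts[OF p' finite_vertex_pairs e])
       (simp only: diff_divide_distrib)
  finally have parts: "E (\<lambda>w. of_real (wigner n p w $$ (i,j)) * G w j i) = (p * (1 - p)) *\<^sub>R E ?D" .
  have "E (\<lambda>w. of_real (wigner n p w $$ (i,j)) * G w j i) + of_real (p * (1 - p) / real n) * E ?Q
     = (p * (1 - p)) *\<^sub>R (E ?D + E ?Q / of_nat n)"
    unfolding parts scaleR_conv_of_real
    by (simp only: distrib_left of_real_divide of_real_of_nat_eq times_divide_eq_right times_divide_eq_left)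
  also have "E ?D + E ?Q / of_nat n = E ?r"
    by simp
  finally have eq: "E (\<lambda>w. of_real (wigner n p w $$ (i,j)) * G w j i) + of_real (p * (1 - p) / real n) * E ?Q
     = (p * (1 - p)) *\<^sub>R E ?r" .
  have "cmod (?r w) \<le> 8 / (sqrt (real n) * t ^ 3) / real n" for w
  proof -
    let ?G1 = "G (w(?e := True))" and ?G0 = "G (w(?e := False))"
    have nb: "cmod (G w' a b) \<le> 1 / t" if "a < n" "b < n" for a b w'
      using that by (intro resolvent_entry_norm[OF wigner_carrier wigner_sym t])
    have lip: "cmod (G (w(?e := b)) k l - G w k l) \<le> 2 * ?h / t\<^sup>2" if "k < n" "l < n" for b k l
    proof -
      \<comment> \<open>Setting the edge to its own value does nothing, so this compares with the unmodified graph as well.\<close>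
      let ?h' = "(of_bool (w ?e) - of_bool b) / sqrt (real n)"
      have "cmod (G (w(?e := b)) k l - G (w(?e := w ?e)) k l) \<le> 2 * \<bar>?h'\<bar> / t\<^sup>2"
        by (rule resolvent_entry_lipschitz[OF wigner_carrier wigner_sym wigner_carrier wigner_sym t ij wigner_update[OF ij] that])
      also have "\<dots> \<le> 2 * ?h / t\<^sup>2"
        by (intro divide_right_mono mult_left_mono) (auto simp: of_bool_def)
      finally show ?thesis by simp
    qed
    have prod: "cmod (G w a b * G w c d - ?G1 a b * ?G0 c d) \<le> 4 * ?h / t ^ 3"
      if "a < n" "b < n" "c < n" "d < n" for a b c d
    proof -
      have "G w a b * G w c d - ?G1 a b * ?G0 c d
         = - (G w a b * (?G0 c d - G w c d)) - (?G1 a b - G w a b) * ?G0 c d"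
        by (simp add: algebra_simps)
      then have "cmod (G w a b * G w c d - ?G1 a b * ?G0 c d)
         \<le> cmod (G w a b) * cmod (?G0 c d - G w c d) + cmod (?G1 a b - G w a b) * cmod (?G0 c d)"
        using norm_triangle_ineq4[of "- (G w a b * (?G0 c d - G w c d))" "(?G1 a b - G w a b) * ?G0 c d"]
        by (simp add: norm_mult)
      also have "\<dots> \<le> 1 / t * (2 * ?h / t\<^sup>2) + 2 * ?h / t\<^sup>2 * (1 / t)"
        using that t by (intro add_mono mult_mono nb lip) auto
      also have "\<dots> = 4 * ?h / t ^ 3" by (simp add: power2_eq_square power3_eq_cube)
      finally show ?thesis .
    qed
    have "?G1 j i - ?G0 j i = of_real (- ?h) * (?G1 j i * ?G0 j i + ?G1 j j * ?G0 i i)"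
      by (rule resolvent_two_entries[OF wigner_carrier wigner_sym wigner_carrier wigner_sym t ij ij(2,1)])
        (simp add: wigner_update[OF ij])
    then have "?D w = of_real (- ?h) * (?G1 j i * ?G0 j i + ?G1 j j * ?G0 i i) / of_real (sqrt (real n))"
      by (simp only:)
    also have "\<dots> = of_real (- ?h / sqrt (real n)) * (?G1 j i * ?G0 j i + ?G1 j j * ?G0 i i)"
      by (simp only: of_real_divide times_divide_eq_left)
    also have "- ?h / sqrt (real n) = - 1 / real n" by simp
    finally have D: "?D w = - (?G1 j i * ?G0 j i + ?G1 j j * ?G0 i i) / of_nat n"
      by (simp only: of_real_divide of_real_minus of_real_1 of_real_of_nat_eq times_divide_eq_left
          mult_minus_left mult_1)
    have "?r w = ((G w j i * G w j i - ?G1 j i * ?G0 j i) + (G w j j * G w i i - ?G1 j j * ?G0 i i)) / of_nat n"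
      unfolding D by (simp add: power2_eq_square add_divide_distrib diff_divide_distrib)
    then have "cmod (?r w) = cmod ((G w j i * G w j i - ?G1 j i * ?G0 j i) + (G w j j * G w i i - ?G1 j j * ?G0 i i)) / real n"
      by (simp only: norm_divide norm_of_nat)
    also have "\<dots> \<le> (4 * ?h / t ^ 3 + 4 * ?h / t ^ 3) / real n"
      using ij by (intro divide_right_mono order.trans[OF norm_triangle_ineq] add_mono prod) auto
    finally show ?thesis by simp
  qed
  then have "cmod (E ?r) \<le> 8 / (sqrt (real n) * t ^ 3) / real n"
    by (rule norm_expectation_le)
  then have "p * (1 - p) * cmod (E ?r) \<le> p * (1 - p) * (8 / (sqrt (real n) * t ^ 3) / real n)"
    using p by (intro mult_left_mono) auto
  moreover have "cmod ((p * (1 - p)) *\<^sub>R E ?r) = p * (1 - p) * cmod (E ?r)"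
    using p by simp
  moreover have "p * (1 - p) * (8 / (sqrt (real n) * t ^ 3) / real n) = p * (1 - p) / real n * (8 / (sqrt (real n) * t ^ 3))"
    by (simp add: field_simps)
  ultimately show ?thesis unfolding eq by (simp only:)
qed

text \<open>
  Only the products \<open>G\<^sub>j\<^sub>j G\<^sub>i\<^sub>i\<close> matter, whose sum is \<open>(n s)\<^sup>2\<close>. The squares \<open>G\<^sub>j\<^sub>i\<^sup>2\<close> sum to \<open>O(n)\<close> by the bound on rows, and
  so do the diagonal terms.
\<close>

lemma pair_sum_approximates_square:
  "cmod ((\<Sum>i<n. \<Sum>j<n. if i = j then 0 else (G w j i)\<^sup>2 + G w j j * G w i i) / (of_nat n)\<^sup>2 - (s w)\<^sup>2)
    \<le> 3 / (real n * t\<^sup>2)"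
proof -
  let ?S1 = "\<Sum>i<n. \<Sum>j<n. (G w j i)\<^sup>2" and ?S2 = "\<Sum>i<n. (G w i i)\<^sup>2"
  have "(\<Sum>i<n. \<Sum>j<n. if i = j then 0 else (G w j i)\<^sup>2 + G w j j * G w i i)
     = (\<Sum>i<n. \<Sum>j<n. (G w j i)\<^sup>2 + G w j j * G w i i - (if i = j then 2 * (G w j j)\<^sup>2 else 0))"
    by (intro sum.cong refl) (auto simp: power2_eq_square)
  also have "\<dots> = ?S1 + (\<Sum>i<n. \<Sum>j<n. G w j j * G w i i) - 2 * ?S2"
    by (simp add: sum.distrib sum_subtractf sum_distrib_left)
  also have "(\<Sum>i<n. \<Sum>j<n. G w j j * G w i i) = (\<Sum>i<n. G w i i)\<^sup>2"
    by (simp add: power2_eq_square sum_product mult.commute)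
  finally have "(\<Sum>i<n. \<Sum>j<n. if i = j then 0 else (G w j i)\<^sup>2 + G w j j * G w i i) / (of_nat n)\<^sup>2 - (s w)\<^sup>2
      = (?S1 - 2 * ?S2) / (of_nat n)\<^sup>2"
    by (simp add: stieltjes_def power_divide diff_divide_distrib add_divide_distrib)
  then have "cmod ((\<Sum>i<n. \<Sum>j<n. if i = j then 0 else (G w j i)\<^sup>2 + G w j j * G w i i) / (of_nat n)\<^sup>2 - (s w)\<^sup>2)
      = cmod (?S1 - 2 * ?S2) / (real n)\<^sup>2"
    by (simp only: norm_divide norm_power norm_of_nat)
  also have "\<dots> \<le> (real n * (1 / t\<^sup>2) + 2 * (real n * (1 / t\<^sup>2))) / (real n)\<^sup>2"
  proof (intro divide_right_mono order.trans[OF norm_triangle_ineq4] add_mono)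
    have "cmod ?S1 \<le> (\<Sum>i<n. 1 / t\<^sup>2)"
    proof (rule sum_norm_le)
      fix i assume i: "i \<in> {..<n}"
      have "cmod (\<Sum>j<n. (G w j i)\<^sup>2) \<le> (\<Sum>j<n. (cmod (G w i j))\<^sup>2)"
        by (rule sum_norm_le) (simp add: norm_power resolvent_sym[of n _ t _ i])
      also have "\<dots> \<le> 1 / t\<^sup>2"
        using i by (intro resolvent_row_norm[OF wigner_carrier wigner_sym t]) auto
      finally show "cmod (\<Sum>j<n. (G w j i)\<^sup>2) \<le> 1 / t\<^sup>2" .
    qed
    then show "cmod ?S1 \<le> real n * (1 / t\<^sup>2)" by simp
    have "cmod ?S2 \<le> (\<Sum>i<n. 1 / t\<^sup>2)"
    proof (rule sum_norm_le)
      fix i assume i: "i \<in> {..<n}"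
      have "(cmod (G w i i))\<^sup>2 \<le> (1 / t)\<^sup>2"
        using i by (intro power_mono resolvent_entry_norm[OF wigner_carrier wigner_sym t]) auto
      then show "cmod ((G w i i)\<^sup>2) \<le> 1 / t\<^sup>2" by (simp add: norm_power power_divide)
    qed
    then show "cmod (2 * ?S2) \<le> 2 * (real n * (1 / t\<^sup>2))" by (simp add: norm_mult)
  qed simp
  also have "\<dots> = 3 / (real n * t\<^sup>2)" using n by (simp add: field_simps power2_eq_square)
  finally show ?thesis .
qed

text \<open>
  The three error terms come from the integration by parts (\<open>1 / t\<^sup>3\<close>), from the terms other than
  \<open>G\<^sub>j\<^sub>j G\<^sub>i\<^sub>i\<close> (\<open>1 / t\<^sup>2\<close>) and from the variance of the transform (\<open>1 / t\<^sup>4\<close>).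
\<close>

theorem stieltjes_self_consistent:
  "cmod (1 + \<i> * of_real t * E s + of_real (p * (1 - p)) * (E s)\<^sup>2)
     \<le> (8 / t ^ 3 + 3 / t\<^sup>2 + 8 / t ^ 4) / sqrt (real n)"
proof -
  let ?v = "p * (1 - p)"
  let ?Q = "\<lambda>i j w. (G w j i)\<^sup>2 + G w j j * G w i i"
  let ?XG = "\<lambda>i j w. of_real (wigner n p w $$ (i,j)) * G w j i"
  let ?P = "\<lambda>w. (\<Sum>i<n. \<Sum>j<n. if i = j then 0 else ?Q i j w) / (of_nat n)\<^sup>2"
  have v: "0 \<le> ?v" "?v \<le> 1" using p by (auto intro: mult_le_one)
  have "E (\<lambda>w. 1 + \<i> * of_real t * s w) = E (\<lambda>w. (\<Sum>i<n. \<Sum>j<n. ?XG i j w) / of_nat n)"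
    by (simp only: stieltjes_trace_identity)
  also have "\<dots> = (\<Sum>i<n. \<Sum>j<n. E (?XG i j)) / of_nat n"
    by (simp add: integral_sum)
  finally have E1: "E (\<lambda>w. 1 + \<i> * of_real t * s w) = (\<Sum>i<n. \<Sum>j<n. E (?XG i j)) / of_nat n" .
  have "E ?P = (\<Sum>i<n. \<Sum>j<n. E (\<lambda>w. if i = j then 0 else ?Q i j w)) / (of_nat n)\<^sup>2"
    by (simp add: integral_sum)
  also have "\<dots> = (\<Sum>i<n. \<Sum>j<n. if i = j then 0 else E (?Q i j)) / (of_nat n)\<^sup>2"
    by (intro arg_cong2[where f = "(/)"] sum.cong refl) auto
  finally have E2: "E ?P = (\<Sum>i<n. \<Sum>j<n. if i = j then 0 else E (?Q i j)) / (of_nat n)\<^sup>2" .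
  have "E (\<lambda>w. 1 + \<i> * of_real t * s w) + of_real ?v * E ?P =
      (\<Sum>i<n. \<Sum>j<n. E (?XG i j) + (if i = j then 0 else of_real (?v / real n) * E (?Q i j))) / of_nat n"
  proof -
    have "(\<Sum>i<n. \<Sum>j<n. if i = j then 0 else of_real (?v / real n) * E (?Q i j))
        = (\<Sum>i<n. \<Sum>j<n. of_real (?v / real n) * (if i = j then 0 else E (?Q i j)))"
      by (intro sum.cong refl) (simp only: if_distrib[where f = "(*) _"] mult_zero_right)
    also have "\<dots> = of_real (?v / real n) * (\<Sum>i<n. \<Sum>j<n. if i = j then 0 else E (?Q i j))"
      by (simp only: sum_distrib_left)
    finally show ?thesis
      unfolding E1 E2 sum.distrib add_divide_distrib by (simp add: power2_eq_square)
  qed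
  then have "cmod (E (\<lambda>w. 1 + \<i> * of_real t * s w) + of_real ?v * E ?P) =
      cmod (\<Sum>i<n. \<Sum>j<n. E (?XG i j) + (if i = j then 0 else of_real (?v / real n) * E (?Q i j))) / real n"
    by (simp only: norm_divide norm_of_nat)
  also have "\<dots> \<le> (\<Sum>i<n. \<Sum>j<n. ?v / real n * (8 / (sqrt (real n) * t ^ 3))) / real n"
  proof (intro divide_right_mono sum_norm_le)
    fix i j assume "i \<in> {..<n}" "j \<in> {..<n}"
    then have ij: "i < n" "j < n" by auto
    show "cmod (E (?XG i j) + (if i = j then 0 else of_real (?v / real n) * E (?Q i j)))
        \<le> ?v / real n * (8 / (sqrt (real n) * t ^ 3))"
    proof (cases "i = j")
      case True
      then show ?thesis using ij p t by (simp add: wigner_def)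
    next
      case False
      then show ?thesis using expectation_entry_times_resolvent[OF ij False] by simp
    qed
  qed simp
  also have "\<dots> = ?v * (8 / (sqrt (real n) * t ^ 3))" using n by simp
  also have "\<dots> \<le> 8 / (sqrt (real n) * t ^ 3)" using v t by (intro mult_left_le_one_le) auto
  finally have b1: "cmod (E (\<lambda>w. 1 + \<i> * of_real t * s w) + of_real ?v * E ?P) \<le> 8 / (sqrt (real n) * t ^ 3)" .
  have diff: "E (\<lambda>w. ?P w - (s w)\<^sup>2) = E ?P - E (\<lambda>w. (s w)\<^sup>2)"
    by (rule Bochner_Integration.integral_diff) auto
  have b2: "cmod (E ?P - E (\<lambda>w. (s w)\<^sup>2)) \<le> 3 / (real n * t\<^sup>2)"
    unfolding diff[symmetric] by (intro norm_expectation_le pair_sum_approximates_square)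
  note b3 = expectation_square_stieltjes
  have eq: "1 + \<i> * of_real t * E s + of_real ?v * (E s)\<^sup>2 =
      (E (\<lambda>w. 1 + \<i> * of_real t * s w) + of_real ?v * E ?P)
      - of_real ?v * ((E ?P - E (\<lambda>w. (s w)\<^sup>2)) + (E (\<lambda>w. (s w)\<^sup>2) - (E s)\<^sup>2))"
  proof -
    have "E (\<lambda>w. 1 + \<i> * of_real t * s w) = 1 + \<i> * of_real t * E s" by simp
    then show ?thesis by (simp only: algebra_simps)
  qed
  have "cmod (1 + \<i> * of_real t * E s + of_real ?v * (E s)\<^sup>2)
      \<le> 8 / (sqrt (real n) * t ^ 3) + 1 * (3 / (real n * t\<^sup>2) + 8 / (real n * t ^ 4))"
    unfolding eq using v by (intro order.trans[OF norm_triangle_ineq4] add_mono b1)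
      (simp only: norm_mult norm_of_real abs_of_nonneg, intro mult_mono order.trans[OF norm_triangle_ineq] add_mono b2 b3, auto)
  also have "\<dots> \<le> 8 / (sqrt (real n) * t ^ 3) + 1 * (3 / (sqrt (real n) * t\<^sup>2) + 8 / (sqrt (real n) * t ^ 4))"
  proof -
    have "sqrt (real n) \<le> real n" using n by (simp add: real_le_lsqrt power2_eq_square)
    then show ?thesis using n t
      by (intro add_mono mult_left_mono divide_left_mono mult_right_mono mult_pos_pos) auto
  qed
  also have "\<dots> = (8 / t ^ 3 + 3 / t\<^sup>2 + 8 / t ^ 4) / sqrt (real n)"
    by (simp add: add_divide_distrib mult.commute)
  finally show ?thesis .
qed

theorem stieltjes_L1_estimate:
  assumes m: "m \<ge> 0" "t * m + p * (1 - p) * m\<^sup>2 = 1"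
  shows "E (\<lambda>w. \<bar>Im (s w) - m\<bar>)
     \<le> (2 / t ^ 4 + 1 / 2 + (8 / t ^ 3 + 3 / t\<^sup>2 + 8 / t ^ 4) / t) / sqrt (real n)"
proof -
  let ?r = "sqrt (real n)"
  have r: "?r > 0" "?r * ?r = real n" using n by auto
  \<comment> \<open>The inequality \<open>2 y \<le> r y\<^sup>2 + 1 / r\<close> with \<open>r = sqrt n\<close> turns the variance, of order \<open>1 / n\<close>, into a first moment of order \<open>1 / sqrt n\<close>.\<close>
  have pt: "\<bar>Im (s w) - m\<bar> \<le> (?r * (Im (s w) - Im (E s))\<^sup>2 + 1 / ?r) / 2 + \<bar>Im (E s) - m\<bar>" for w
  proof -
    have "0 \<le> (?r * \<bar>Im (s w) - Im (E s)\<bar> - 1)\<^sup>2" by simp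
    then have "2 * \<bar>Im (s w) - Im (E s)\<bar> * ?r \<le> (?r * (Im (s w) - Im (E s))\<^sup>2 + 1 / ?r) * ?r"
      using r by (simp add: power2_diff power_mult_distrib algebra_simps power2_eq_square)
    then have "2 * \<bar>Im (s w) - Im (E s)\<bar> \<le> ?r * (Im (s w) - Im (E s))\<^sup>2 + 1 / ?r"
      using r by simp
    moreover have "\<bar>Im (s w) - m\<bar> \<le> \<bar>Im (s w) - Im (E s)\<bar> + \<bar>Im (E s) - m\<bar>" by linarith
    moreover have "x \<le> b / 2 + c" if "2 * a \<le> b" "x \<le> a + c" for a b c x :: real
      using that by linarith
    ultimately show ?thesis by blast
  qed
  have "E (\<lambda>w. \<bar>Im (s w) - m\<bar>) \<le> E (\<lambda>w. (?r * (Im (s w) - Im (E s))\<^sup>2 + 1 / ?r) / 2 + \<bar>Im (E s) - m\<bar>)"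
    by (rule integral_mono) (auto intro: pt)
  also have "\<dots> = (?r * E (\<lambda>w. (Im (s w) - Im (E s))\<^sup>2) + 1 / ?r) / 2 + \<bar>Im (E s) - m\<bar>"
    by simp
  also have "\<dots> \<le> (?r * (4 / (real n * t ^ 4)) + 1 / ?r) / 2 + (8 / t ^ 3 + 3 / t\<^sup>2 + 8 / t ^ 4) / ?r / t"
  proof (intro add_mono divide_right_mono mult_left_mono stieltjes_variance(2))
    have Im: "Im (E s) = E (\<lambda>w. Im (s w))" by simp
    have "0 \<le> Im (E s)" unfolding Im by (rule integral_nonneg_AE) (simp add: Im_stieltjes_nonneg)
    have "\<bar>Im (E s) - m\<bar> \<le> cmod (E s - \<i> * of_real m)"
      using abs_Im_le_cmod[of "E s - \<i> * of_real m"] by simp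
    also have "\<dots> \<le> cmod (1 + \<i> * of_real t * E s + of_real (p * (1 - p)) * (E s)\<^sup>2) / t"
      by (rule self_consistent_stability) (use t p m \<open>0 \<le> Im (E s)\<close> in auto)
    also have "\<dots> \<le> (8 / t ^ 3 + 3 / t\<^sup>2 + 8 / t ^ 4) / ?r / t"
      using t by (intro divide_right_mono stieltjes_self_consistent) auto
    finally show "\<bar>Im (E s) - m\<bar> \<le> (8 / t ^ 3 + 3 / t\<^sup>2 + 8 / t ^ 4) / ?r / t" .
  qed (use r in auto)
  also have "\<dots> = (2 / t ^ 4 + 1 / 2 + (8 / t ^ 3 + 3 / t\<^sup>2 + 8 / t ^ 4) / t) / ?r"
  proof -
    have "x * (4 / (x * x * y)) = 4 / y / x" if "x > 0" for x y :: real
      using that by simp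
    from this[OF r(1), unfolded r(2)] have "?r * (4 / (real n * t ^ 4)) = 4 / t ^ 4 / ?r" .
    then show ?thesis by (simp add: add_divide_distrib mult_ac)
  qed
  finally show ?thesis .
qed

end

section \<open>The mean absolute eigenvalue of a Wigner matrix\<close>

text \<open>
  For \<open>t > 0\<close> the integrand is \<open>x\<^sup>2 / (x\<^sup>2 + t\<^sup>2)\<close>. It is written as \<open>1 - t (t / (x\<^sup>2 + t\<^sup>2))\<close> because
  \<open>t / (x\<^sup>2 + t\<^sup>2)\<close> is the contribution of an eigenvalue \<open>x\<close> to the imaginary part of the resolvent's trace.
\<close>

lemma has_integral_lorentz_tail:
  fixes x a b :: real
  assumes "0 < a" "a \<le> b"
  shows "((\<lambda>t. 1 - t * (t / (x\<^sup>2 + t\<^sup>2))) has_integral (x * arctan (b / x) - x * arctan (a / x))) {a..b}"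
proof (rule fundamental_theorem_of_calculus[OF \<open>a \<le> b\<close>])
  fix t assume "t \<in> {a..b}"
  then have t: "t > 0" using assms by simp
  show "((\<lambda>t. x * arctan (t / x)) has_vector_derivative 1 - t * (t / (x\<^sup>2 + t\<^sup>2))) (at t within {a..b})"
  proof (cases "x = 0")
    case True
    then show ?thesis using t by (simp add: power2_eq_square)
  next
    case False
    have "x\<^sup>2 + t\<^sup>2 > 0" using False by (simp add: add_pos_nonneg)
    then have "1 - t * (t / (x\<^sup>2 + t\<^sup>2)) = x * (1 / x * inverse (1 + (t / x)\<^sup>2))"
      using False by (simp add: field_simps power2_eq_square)
    moreover have "((\<lambda>t. x * arctan (t / x)) has_real_derivative x * (1 / x * inverse (1 + (t / x)\<^sup>2))) (at t within {a..b})"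
      using False by (auto intro!: derivative_eq_intros)
    ultimately show ?thesis by (simp add: has_real_derivative_iff_has_vector_derivative)
  qed
qed

text \<open>
  The missing pieces of the integral over \<open>t > 0\<close> are at most \<open>a\<close>, as the integrand is at most \<open>1\<close> on
  \<open>[0, a]\<close>, and \<open>x\<^sup>2 / b\<close>, as it is at most \<open>x\<^sup>2 / t\<^sup>2\<close> beyond \<open>b\<close>.
\<close>

lemma abs_arctan_integral_bounds:
  fixes x a b :: real
  assumes "0 < a" "0 < b"
  shows "\<bar>pi / 2 * \<bar>x\<bar> - (x * arctan (b / x) - x * arctan (a / x))\<bar> \<le> a + x\<^sup>2 / b"
proof (cases "x = 0")
  case True
  then show ?thesis using assms by simp
next
  case False
  define y where "y = \<bar>x\<bar>"
  have y: "y > 0" using False by (simp add: y_def)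
  have even: "x * arctan (c / x) = y * arctan (c / y)" for c
    using False by (cases "x > 0") (auto simp: y_def arctan_minus)
  have le: "arctan z \<le> z" if "z \<ge> 0" for z :: real
    using arctan_le_self[OF that] .
  have "y * arctan (a / y) \<le> y * (a / y)" using y assms by (intro mult_left_mono le) auto
  then have 1: "y * arctan (a / y) \<le> a" using y by simp
  have 2: "0 \<le> y * arctan (a / y)" using y assms by simp
  have "arctan (b / y) = pi / 2 - arctan (y / b)"
    using arctan_inverse[of "y / b"] y assms by (simp add: sgn_if)
  then have 3: "pi / 2 * y - y * arctan (b / y) = y * arctan (y / b)" by (simp only: right_diff_distrib mult.commute)
  have "y * arctan (y / b) \<le> y * (y / b)" using y assms by (intro mult_left_mono le) auto
  then have 4: "y * arctan (y / b) \<le> x\<^sup>2 / b" by (simp add: y_def power2_eq_square)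
  have 5: "0 \<le> y * arctan (y / b)" using y assms by simp
  show ?thesis unfolding even using 1 2 3 4 5 by (simp add: y_def[symmetric])
qed

lemma sum_eigenvalue_squares:
  assumes D: "spectral_decomposition n A U d"
  shows "(\<Sum>k<n. (d k)\<^sup>2) = (\<Sum>i<n. \<Sum>j<n. (A $$ (i,j))\<^sup>2)"
proof -
  note C = orthonormal_columns[OF D] and R = orthonormal_rows[OF D] and S = spectral_entry[OF D]
  have "(\<Sum>j<n. (A $$ (i,j))\<^sup>2) = (\<Sum>k<n. (d k)\<^sup>2 * (U $$ (i,k) * U $$ (i,k)))" if i: "i < n" for i
  proof -
    have "(\<Sum>j<n. (A $$ (i,j))\<^sup>2) = (\<Sum>j<n. (\<Sum>k<n. (d k * U $$ (i,k)) * U $$ (j,k))\<^sup>2)"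
      using i by (intro sum.cong refl) (simp add: S mult.assoc)
    also have "\<dots> = (\<Sum>k<n. (d k * U $$ (i,k))\<^sup>2)"
      using orthogonal_sum_squares[of n "\<lambda>k j. U $$ (j,k)"] C by simp
    finally show ?thesis by (simp add: power_mult_distrib power2_eq_square mult_ac)
  qed
  then have "(\<Sum>i<n. \<Sum>j<n. (A $$ (i,j))\<^sup>2) = (\<Sum>i<n. \<Sum>k<n. (d k)\<^sup>2 * (U $$ (i,k) * U $$ (i,k)))"
    by (rule sum.cong[OF refl]) simp
  also have "\<dots> = (\<Sum>k<n. (d k)\<^sup>2 * (\<Sum>i<n. U $$ (i,k) * U $$ (i,k)))"
    by (subst sum.swap) (simp only: sum_distrib_left)
  also have "\<dots> = (\<Sum>k<n. (d k)\<^sup>2)" using C by simp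
  finally show ?thesis ..
qed

lemma wigner_frobenius_le:
  assumes "0 \<le> p" "p \<le> 1"
  shows "(\<Sum>i<n. \<Sum>j<n. (wigner n p w $$ (i,j))\<^sup>2) \<le> real n"
proof -
  have "(\<Sum>i<n. \<Sum>j<n. (wigner n p w $$ (i,j))\<^sup>2) \<le> (\<Sum>i<n. \<Sum>j<n. 1 / real n)"
  proof (intro sum_mono)
    fix i j assume "i \<in> {..<n}" "j \<in> {..<n}"
    moreover have "(of_bool (w {Suc i, Suc j}) - p)\<^sup>2 \<le> 1"
      using assms by (cases "w {Suc i, Suc j}") (auto simp: abs_square_le_1)
    ultimately show "(wigner n p w $$ (i,j))\<^sup>2 \<le> 1 / real n"
      by (simp add: wigner_def power_divide divide_right_mono del: of_bool_eq)
  qed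
  also have "\<dots> \<le> real n" by simp
  finally show ?thesis .
qed

lemma Im_stieltjes_eigenvalues:
  obtains U d where "spectral_decomposition n (wigner n p w) U d"
    "\<And>t. Im (stieltjes n p t w) = (\<Sum>k<n. t / ((d k)\<^sup>2 + t\<^sup>2)) / real n"
proof -
  obtain U d where "spectral_decomposition n (wigner n p w) U d"
    "\<And>t. Im (\<Sum>i<n. resolvent n (wigner n p w) t i i) = (\<Sum>k<n. t / ((d k)\<^sup>2 + t\<^sup>2))"
    using resolvent_trace[OF wigner_carrier wigner_sym, of n p w] by blast
  then show ?thesis using that by (simp add: stieltjes_def)
qed

lemma continuous_on_Im_stieltjes:
  assumes "0 < a"
  shows "continuous_on {a..b} (\<lambda>t. Im (stieltjes n p t w))"
proof -
  obtain U d where eq: "\<And>t. Im (stieltjes n p t w) = (\<Sum>k<n. t / ((d k)\<^sup>2 + t\<^sup>2)) / real n"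
    using Im_stieltjes_eigenvalues[of n p w] by blast
  have nz: "(d k)\<^sup>2 + t\<^sup>2 \<noteq> 0" if "t \<in> {a..b}" for k t
    using that assms by (simp add: sum_power2_eq_zero_iff)
  show ?thesis unfolding eq using nz assms by (cases "n = 0") (auto intro!: continuous_intros)
qed

text \<open>
  Summing \<open>abs_arctan_integral_bounds\<close> over the eigenvalues leaves the error
  \<open>a\<close> plus \<open>1 / b\<close> times the mean squared eigenvalue; the latter is at most \<open>1\<close> by the
  Frobenius norm.
\<close>

lemma energy_as_stieltjes_integral:
  assumes "0 \<le> p" "p \<le> 1" "n > 0" "0 < a" "a \<le> b"
  shows "\<bar>pi / 2 * (energy (wigner n p w) / real n) - integral {a..b} (\<lambda>t. 1 - t * Im (stieltjes n p t w))\<bar>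
    \<le> a + 1 / b"
proof -
  obtain U d where D: "spectral_decomposition n (wigner n p w) U d"
    and eq: "\<And>t. Im (stieltjes n p t w) = (\<Sum>k<n. t / ((d k)\<^sup>2 + t\<^sup>2)) / real n"
    using Im_stieltjes_eigenvalues[of n p w] by blast
  let ?I = "\<lambda>x. x * arctan (b / x) - x * arctan (a / x)"
  have "((\<lambda>t. (\<Sum>k<n. 1 - t * (t / ((d k)\<^sup>2 + t\<^sup>2))) / real n) has_integral (\<Sum>k<n. ?I (d k)) / real n) {a..b}"
    using assms by (intro has_integral_divide has_integral_sum has_integral_lorentz_tail) auto
  moreover have "(\<Sum>k<n. 1 - t * (t / ((d k)\<^sup>2 + t\<^sup>2))) / real n = 1 - t * Im (stieltjes n p t w)" for t
    using assms(3) by (simp add: eq sum_subtractf sum_distrib_left diff_divide_distrib)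
  ultimately have I: "integral {a..b} (\<lambda>t. 1 - t * Im (stieltjes n p t w)) = (\<Sum>k<n. ?I (d k)) / real n"
    by (simp add: integral_unique)
  have "pi / 2 * (energy (wigner n p w) / real n) - integral {a..b} (\<lambda>t. 1 - t * Im (stieltjes n p t w))
      = (\<Sum>k<n. pi / 2 * \<bar>d k\<bar> - ?I (d k)) / real n"
    unfolding I energy_spectral_decomposition[OF D]
    by (simp add: sum_subtractf sum_distrib_left diff_divide_distrib)
  then have "\<bar>pi / 2 * (energy (wigner n p w) / real n) - integral {a..b} (\<lambda>t. 1 - t * Im (stieltjes n p t w))\<bar>
      = \<bar>\<Sum>k<n. pi / 2 * \<bar>d k\<bar> - ?I (d k)\<bar> / real n"
    by (simp only: abs_divide abs_of_nat)
  also have "\<dots> \<le> (\<Sum>k<n. a + (d k)\<^sup>2 / b) / real n"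
    using assms by (intro divide_right_mono order.trans[OF sum_abs] sum_mono abs_arctan_integral_bounds) auto
  also have "\<dots> = a + (\<Sum>k<n. (d k)\<^sup>2) / b / real n"
    using assms(3) by (simp add: sum.distrib sum_divide_distrib add_divide_distrib)
  also have "\<dots> \<le> a + real n / b / real n"
    unfolding sum_eigenvalue_squares[OF D]
    using assms by (intro add_left_mono divide_right_mono wigner_frobenius_le) auto
  also have "\<dots> = a + 1 / b" using assms(3) by simp
  finally show ?thesis .
qed

text \<open>
  The Stieltjes transform at \<open>\<i> t\<close> of the semicircle law of variance \<open>v\<close>, divided by \<open>\<i>\<close>.
\<close>

definition semicircle_stieltjes :: "real \<Rightarrow> real \<Rightarrow> real" where
  "semicircle_stieltjes v t = (sqrt (t\<^sup>2 + 4 * v) - t) / (2 * v)"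

lemma semicircle_stieltjes_nonneg: "v > 0 \<Longrightarrow> semicircle_stieltjes v t \<ge> 0"
  unfolding semicircle_stieltjes_def
  by (intro divide_nonneg_nonneg) (auto simp: real_le_rsqrt)

lemma semicircle_stieltjes_equation:
  assumes "v > 0"
  shows "t * semicircle_stieltjes v t + v * (semicircle_stieltjes v t)\<^sup>2 = 1"
proof -
  define r where "r = sqrt (t\<^sup>2 + 4 * v)"
  have r2: "r * r = t * t + 4 * v" using assms by (simp add: r_def power2_eq_square)
  have "t * ((r - t) / (2 * v)) + v * ((r - t) / (2 * v))\<^sup>2 = (2 * t * (r - t) + (r - t)\<^sup>2) / (4 * v)"
    using assms by (simp add: field_simps power2_eq_square)
  also have "2 * t * (r - t) + (r - t)\<^sup>2 = 4 * v"
    by (simp add: power2_eq_square algebra_simps r2)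
  finally show ?thesis using assms by (simp add: semicircle_stieltjes_def r_def)
qed

text \<open>
  A primitive of \<open>1 - t m(t)\<close> for the transform \<open>m\<close> of the semicircle law, with the constant chosen so that
  it vanishes at infinity.
\<close>

definition semicircle_primitive :: "real \<Rightarrow> real \<Rightarrow> real" where
  "semicircle_primitive v t = t + t ^ 3 / (6 * v) - sqrt (t\<^sup>2 + 4 * v) ^ 3 / (6 * v)"

lemma semicircle_integral:
  assumes "v > 0" "a \<le> b"
  shows "((\<lambda>t. 1 - t * semicircle_stieltjes v t) has_integral
     (semicircle_primitive v b - semicircle_primitive v a)) {a..b}"
proof (rule fundamental_theorem_of_calculus[OF \<open>a \<le> b\<close>])
  fix t assume "t \<in> {a..b}"
  have pos: "t\<^sup>2 + 4 * v > 0" using assms(1) by (simp add: add_nonneg_pos)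
  have "(semicircle_primitive v has_real_derivative
      1 + 3 * t\<^sup>2 / (6 * v) - 3 * sqrt (t\<^sup>2 + 4 * v) ^ 2 * (inverse (sqrt (t\<^sup>2 + 4 * v)) / 2 * (2 * t)) / (6 * v))
      (at t within {a..b})"
    unfolding semicircle_primitive_def[abs_def] using pos assms(1)
    by (auto intro!: derivative_eq_intros simp: power2_eq_square) (simp add: field_simps)
  moreover have "1 + 3 * t\<^sup>2 / (6 * v) - 3 * sqrt (t\<^sup>2 + 4 * v) ^ 2 * (inverse (sqrt (t\<^sup>2 + 4 * v)) / 2 * (2 * t)) / (6 * v)
      = 1 - t * semicircle_stieltjes v t"
    using pos assms(1) by (simp add: semicircle_stieltjes_def field_simps power2_eq_square)
  ultimately show "(semicircle_primitive v has_vector_derivative 1 - t * semicircle_stieltjes v t) (at t within {a..b})"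
    by (simp only: has_real_derivative_iff_has_vector_derivative)
qed

lemma semicircle_primitive_at_top:
  assumes "v > 0"
  shows "(semicircle_primitive v \<longlongrightarrow> 0) at_top"
  unfolding semicircle_primitive_def[abs_def] using assms by real_asymp

lemma semicircle_primitive_0: "v > 0 \<Longrightarrow> semicircle_primitive v 0 = - (4 / 3 * sqrt v)"
  by (simp add: semicircle_primitive_def real_sqrt_mult power3_eq_cube)

lemma continuous_on_semicircle_stieltjes:
  "v > 0 \<Longrightarrow> continuous_on S (semicircle_stieltjes v)"
  unfolding semicircle_stieltjes_def by (auto intro!: continuous_intros)

context
  fixes p a b :: real
  assumes p: "0 < p" "p < 1" and ab: "0 < a" "a \<le> b"
begin

private abbreviation (input) "v \<equiv> p * (1 - p)"
private abbreviation (input) "expect n F \<equiv> measure_pmf.expectation (Pi_pmf (vertex_pairs n) False (\<lambda>_. bernoulli_pmf p)) F"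
private abbreviation (input) "K \<equiv> 2 / a ^ 4 + 1 / 2 + (8 / a ^ 3 + 3 / a\<^sup>2 + 8 / a ^ 4) / a"

text \<open>
  On \<open>[a, b]\<close> the estimate of \<open>stieltjes_L1_estimate\<close> is uniform, its constant \<open>K\<close> being the one at \<open>t = a\<close>.
  The expectation is a finite sum, so it commutes with the integral over \<open>t\<close>.
\<close>

lemma expected_integral_deviation:
  assumes n: "n > 0"
  shows "expect n (\<lambda>w. \<bar>integral {a..b} (\<lambda>t. 1 - t * Im (stieltjes n p t w))
     - (semicircle_primitive v b - semicircle_primitive v a)\<bar>) \<le> b * (b - a) * K / sqrt (real n)"
proof -
  have v: "v > 0" using p by simp
  let ?m = "semicircle_stieltjes v"
  let ?P = "Pi_pmf (vertex_pairs n) False (\<lambda>_. bernoulli_pmf p)"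
  let ?f = "\<lambda>w t. \<bar>Im (stieltjes n p t w) - ?m t\<bar>"
  have cf: "continuous_on {a..b} (?f w)" for w
    using ab v by (intro continuous_intros continuous_on_Im_stieltjes continuous_on_semicircle_stieltjes) auto
  have int: "?f w integrable_on {a..b}" for w
    by (rule integrable_continuous_interval[OF cf])
  have pt: "\<bar>integral {a..b} (\<lambda>t. 1 - t * Im (stieltjes n p t w))
     - (semicircle_primitive v b - semicircle_primitive v a)\<bar> \<le> b * integral {a..b} (?f w)" for w
  proof -
    have c1: "continuous_on {a..b} (\<lambda>t. t * (?m t - Im (stieltjes n p t w)))"
      using ab v by (intro continuous_intros continuous_on_Im_stieltjes continuous_on_semicircle_stieltjes) auto
    have c2: "(\<lambda>t. 1 - t * Im (stieltjes n p t w)) integrable_on {a..b}"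
      using ab by (intro integrable_continuous_interval continuous_intros continuous_on_Im_stieltjes) auto
    have "integral {a..b} (\<lambda>t. 1 - t * Im (stieltjes n p t w)) - (semicircle_primitive v b - semicircle_primitive v a)
       = integral {a..b} (\<lambda>t. 1 - t * Im (stieltjes n p t w)) - integral {a..b} (\<lambda>t. 1 - t * ?m t)"
      using integral_unique[OF semicircle_integral[OF v ab(2)]] by simp
    also have "\<dots> = integral {a..b} (\<lambda>t. (1 - t * Im (stieltjes n p t w)) - (1 - t * ?m t))"
      by (rule integral_diff[symmetric, OF c2 has_integral_integrable[OF semicircle_integral[OF v ab(2)]]])
    also have "\<dots> = integral {a..b} (\<lambda>t. t * (?m t - Im (stieltjes n p t w)))"
      by (simp add: algebra_simps)
    finally have eq: "integral {a..b} (\<lambda>t. 1 - t * Im (stieltjes n p t w)) - (semicircle_primitive v b - semicircle_primitive v a)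
      = integral {a..b} (\<lambda>t. t * (?m t - Im (stieltjes n p t w)))" .
    have "norm (integral {a..b} (\<lambda>t. t * (?m t - Im (stieltjes n p t w)))) \<le> integral {a..b} (\<lambda>t. b * ?f w t)"
    proof (rule integral_norm_bound_integral)
      fix t assume t: "t \<in> {a..b}"
      have "norm (t * (?m t - Im (stieltjes n p t w))) = t * ?f w t"
        using t ab by (simp add: abs_mult abs_minus_commute)
      also have "\<dots> \<le> b * ?f w t" using t by (intro mult_right_mono) auto
      finally show "norm (t * (?m t - Im (stieltjes n p t w))) \<le> b * ?f w t" .
    qed (use integrable_continuous_interval[OF c1] integrable_on_mult_right[OF int] in auto)
    then show ?thesis unfolding eq by simp
  qed
  have fin: "finite (set_pmf ?P)"
    by (rule finite_subset[OF set_Pi_pmf_subset'[OF finite_vertex_pairs] finite_PiE_dflt[OF finite_vertex_pairs]]) auto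
  have sumE: "expect n F = (\<Sum>w\<in>set_pmf ?P. F w * pmf ?P w)" for F :: "_ \<Rightarrow> real"
    by (rule integral_measure_pmf_real[OF fin]) auto
  have "expect n (\<lambda>w. \<bar>integral {a..b} (\<lambda>t. 1 - t * Im (stieltjes n p t w))
     - (semicircle_primitive v b - semicircle_primitive v a)\<bar>) \<le> expect n (\<lambda>w. b * integral {a..b} (?f w))"
    by (rule integral_mono) (auto intro: pt)
  also have "\<dots> = b * (\<Sum>w\<in>set_pmf ?P. integral {a..b} (\<lambda>t. ?f w t * pmf ?P w))"
    by (simp add: sumE sum_distrib_left mult_ac)
  also have "(\<Sum>w\<in>set_pmf ?P. integral {a..b} (\<lambda>t. ?f w t * pmf ?P w))
     = integral {a..b} (\<lambda>t. \<Sum>w\<in>set_pmf ?P. ?f w t * pmf ?P w)"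
    by (rule integral_sum[symmetric, OF fin]) (rule integrable_on_mult_left[OF int])
  also have "\<dots> = integral {a..b} (\<lambda>t. expect n (\<lambda>w. ?f w t))"
    by (simp only: sumE)
  also have "b * \<dots> \<le> b * (K / sqrt (real n) * (b - a))"
  proof (rule mult_left_mono)
    have "(\<lambda>t. expect n (\<lambda>w. ?f w t)) integrable_on {a..b}"
      unfolding sumE by (intro integrable_sum fin integrable_on_mult_left int)
    then have "integral {a..b} (\<lambda>t. expect n (\<lambda>w. ?f w t)) \<le> integral {a..b} (\<lambda>t. K / sqrt (real n))"
    proof (rule integral_le)
      fix t assume t: "t \<in> {a..b}"
      then have t0: "t > 0" "a \<le> t" using ab by auto
      have "expect n (\<lambda>w. ?f w t) \<le> (2 / t ^ 4 + 1 / 2 + (8 / t ^ 3 + 3 / t\<^sup>2 + 8 / t ^ 4) / t) / sqrt (real n)"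
        by (rule stieltjes_L1_estimate[OF p t0(1) n semicircle_stieltjes_nonneg[OF v] semicircle_stieltjes_equation[OF v]])
      also have "\<dots> \<le> K / sqrt (real n)"
        using t0 ab(1) by (intro divide_right_mono add_mono frac_le divide_left_mono power_mono mult_pos_pos zero_less_power) auto
      finally show "expect n (\<lambda>w. ?f w t) \<le> K / sqrt (real n)" .
    qed auto
    also have "\<dots> = K / sqrt (real n) * (b - a)" using ab by simp
    finally show "integral {a..b} (\<lambda>t. expect n (\<lambda>w. ?f w t)) \<le> K / sqrt (real n) * (b - a)" .
  qed (use ab in auto)
  finally show ?thesis by (simp add: mult_ac)
qed

lemma expected_wigner_energy_deviation:
  assumes n: "n > 0"
  shows "expect n (\<lambda>w. \<bar>pi / 2 * (energy (wigner n p w) / real n) - 4 / 3 * sqrt v\<bar>) \<le>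
     a + 1 / b + \<bar>semicircle_primitive v b\<bar> + \<bar>semicircle_primitive v a - semicircle_primitive v 0\<bar>
     + b * (b - a) * K / sqrt (real n)"
proof -
  have v: "v > 0" using p by simp
  let ?I = "\<lambda>w. integral {a..b} (\<lambda>t. 1 - t * Im (stieltjes n p t w))"
  let ?F = "semicircle_primitive v"
  let ?c = "a + 1 / b + \<bar>?F b\<bar> + \<bar>?F a - ?F 0\<bar>"
  have "expect n (\<lambda>w. \<bar>pi / 2 * (energy (wigner n p w) / real n) - 4 / 3 * sqrt v\<bar>)
      \<le> expect n (\<lambda>w. ?c + \<bar>?I w - (?F b - ?F a)\<bar>)"
  proof (rule integral_mono)
    fix w
    have "\<bar>pi / 2 * (energy (wigner n p w) / real n) - ?I w\<bar> \<le> a + 1 / b"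
      using p n ab by (intro energy_as_stieltjes_integral) auto
    then show "\<bar>pi / 2 * (energy (wigner n p w) / real n) - 4 / 3 * sqrt v\<bar> \<le> ?c + \<bar>?I w - (?F b - ?F a)\<bar>"
      using semicircle_primitive_0[OF v] by linarith
  qed auto
  also have "\<dots> = ?c + expect n (\<lambda>w. \<bar>?I w - (?F b - ?F a)\<bar>)" by simp
  also have "\<dots> \<le> ?c + b * (b - a) * K / sqrt (real n)"
    by (intro add_left_mono expected_integral_deviation[OF n])
  finally show ?thesis .
qed

end

text \<open>
  For a fixed window \<open>[a, b]\<close> the error has a part depending on the window alone and a part of order
  \<open>1 / sqrt n\<close>. The windows \<open>[1 / k, k]\<close> make the first part tend to \<open>0\<close>.
\<close>

theorem wigner_energy_L1_limit:
  assumes p: "0 < p" "p < 1"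
  shows "(\<lambda>n. measure_pmf.expectation (Pi_pmf (vertex_pairs n) False (\<lambda>_. bernoulli_pmf p))
      (\<lambda>w. \<bar>energy (wigner n p w) / real n - 8 / (3 * pi) * sqrt (p * (1 - p))\<bar>)) \<longlonglongrightarrow> 0"
proof -
  define v where "v = p * (1 - p)"
  have v: "v > 0" using p by (simp add: v_def)
  let ?F = "semicircle_primitive v"
  define D where "D n = measure_pmf.expectation (Pi_pmf (vertex_pairs n) False (\<lambda>_. bernoulli_pmf p))
      (\<lambda>w. \<bar>pi / 2 * (energy (wigner n p w) / real n) - 4 / 3 * sqrt v\<bar>)" for n
  have D0: "0 \<le> D n" for n unfolding D_def by (rule integral_nonneg_AE) simp
  have err: "(\<lambda>k. inverse (real k) + 1 / real k + \<bar>?F (real k)\<bar> + \<bar>?F (inverse (real k)) - ?F 0\<bar>) \<longlonglongrightarrow> 0"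
  proof -
    have "isCont ?F 0" unfolding semicircle_primitive_def[abs_def] using v by (auto intro!: continuous_intros)
    then have "(\<lambda>k. ?F (inverse (real k))) \<longlonglongrightarrow> ?F 0"
      by (rule isCont_tendsto_compose) (rule lim_inverse_n)
    then have 1: "(\<lambda>k. \<bar>?F (inverse (real k)) - ?F 0\<bar>) \<longlonglongrightarrow> 0"
      by (intro tendsto_rabs_zero) (simp add: LIM_zero)
    have 2: "(\<lambda>k. \<bar>?F (real k)\<bar>) \<longlonglongrightarrow> 0"
      by (intro tendsto_rabs_zero filterlim_compose[OF semicircle_primitive_at_top[OF v] filterlim_real_sequentially])
    show ?thesis
      using tendsto_add[OF tendsto_add[OF tendsto_add[OF lim_inverse_n lim_1_over_n] 2] 1] by simp
  qed
  have "D \<longlonglongrightarrow> 0"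
  proof (rule LIMSEQ_I)
    fix e :: real assume e: "e > 0"
    obtain k0 where k0: "\<And>k. k \<ge> k0 \<Longrightarrow> \<bar>inverse (real k) + 1 / real k + \<bar>?F (real k)\<bar> + \<bar>?F (inverse (real k)) - ?F 0\<bar>\<bar> < e / 2"
      using LIMSEQ_D[OF err, of "e / 2"] e by auto
    define k where "k = max k0 1"
    let ?a = "inverse (real k)" and ?b = "real k"
    have ab: "0 < ?a" "?a \<le> ?b"
      by (auto simp: k_def inverse_le_1_iff intro: order.trans[of _ 1])
    obtain C where C: "\<And>n. n > 0 \<Longrightarrow> D n \<le> ?a + 1 / ?b + \<bar>?F ?b\<bar> + \<bar>?F ?a - ?F 0\<bar> + C / sqrt (real n)"
      using expected_wigner_energy_deviation[OF p ab] unfolding D_def v_def by blast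
    have "(\<lambda>n. C / sqrt (real n)) \<longlonglongrightarrow> 0" by real_asymp
    then obtain n0 where n0: "\<And>n. n \<ge> n0 \<Longrightarrow> \<bar>C / sqrt (real n)\<bar> < e / 2"
      using LIMSEQ_D[of _ 0 "e / 2"] e by fastforce
    have "norm (D n - 0) < e" if "n \<ge> max n0 1" for n
    proof -
      have "D n \<le> ?a + 1 / ?b + \<bar>?F ?b\<bar> + \<bar>?F ?a - ?F 0\<bar> + C / sqrt (real n)" using C that by simp
      moreover have "?a + 1 / ?b + \<bar>?F ?b\<bar> + \<bar>?F ?a - ?F 0\<bar> < e / 2"
        using k0[of k] by (simp add: k_def)
      moreover have "\<bar>C / sqrt (real n)\<bar> < e / 2" by (rule n0) (use that in simp)
      then have "C / sqrt (real n) < e / 2" by (rule le_less_trans[OF abs_ge_self])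
      ultimately have "D n < e" by linarith
      then show ?thesis using D0[of n] by simp
    qed
    then show "\<exists>no. \<forall>n\<ge>no. norm (D n - 0) < e" by blast
  qed
  then have "(\<lambda>n. 2 / pi * D n) \<longlonglongrightarrow> 0" by (rule tendsto_mult_right_zero)
  moreover have "2 / pi * D n = measure_pmf.expectation (Pi_pmf (vertex_pairs n) False (\<lambda>_. bernoulli_pmf p))
      (\<lambda>w. \<bar>energy (wigner n p w) / real n - 8 / (3 * pi) * sqrt (p * (1 - p))\<bar>)" for n
  proof -
    have eq: "2 / pi * \<bar>pi / 2 * x - 4 / 3 * sqrt v\<bar> = \<bar>x - 8 / (3 * pi) * sqrt v\<bar>" for x
    proof -
      have "2 / pi * \<bar>pi / 2 * x - 4 / 3 * sqrt v\<bar> = \<bar>2 / pi * (pi / 2 * x - 4 / 3 * sqrt v)\<bar>"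
        by (simp only: abs_mult) simp
      also have "2 / pi * (pi / 2 * x - 4 / 3 * sqrt v) = x - 8 / (3 * pi) * sqrt v"
        by (simp add: field_simps)
      finally show ?thesis .
    qed
    have "2 / pi * D n = measure_pmf.expectation (Pi_pmf (vertex_pairs n) False (\<lambda>_. bernoulli_pmf p))
      (\<lambda>w. 2 / pi * \<bar>pi / 2 * (energy (wigner n p w) / real n) - 4 / 3 * sqrt v\<bar>)"
      unfolding D_def by (rule integral_mult_right_zero[symmetric])
    then show ?thesis by (simp only: eq) (simp only: v_def)
  qed
  ultimately show ?thesis by (simp only:)
qed

section \<open>The arithmetic-geometric matrix of a random graph\<close>

lemma energy_smult:
  assumes A: "A \<in> carrier_mat n n" "A\<^sup>T = A"
  shows "energy (c \<cdot>\<^sub>m A) = \<bar>c\<bar> * energy A"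
proof -
  obtain U d where D: "spectral_decomposition n A U d"
    using real_spectral_theorem[OF A] by blast
  then have U: "U \<in> carrier_mat n n" "U\<^sup>T * U = 1\<^sub>m n" "U * U\<^sup>T = 1\<^sub>m n" and
    AU: "A = U * mat_diag n d * U\<^sup>T"
    by (auto simp: spectral_decomposition_def)
  have m: "mat_diag n (\<lambda>k. c * d k) = c \<cdot>\<^sub>m mat_diag n d"
    by (rule eq_matI) (auto simp: mat_diag_def)
  have "U * mat_diag n (\<lambda>k. c * d k) * U\<^sup>T = c \<cdot>\<^sub>m (U * mat_diag n d * U\<^sup>T)"
    unfolding m using U(1)
    by (subst mult_smult_distrib[of _ n n _ n], (simp_all)[2], subst mult_smult_assoc_mat[of _ n n _ n]) auto
  then have "spectral_decomposition n (c \<cdot>\<^sub>m A) U (\<lambda>k. c * d k)"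
    using U AU by (simp add: spectral_decomposition_def)
  from energy_spectral_decomposition[OF this] energy_spectral_decomposition[OF D]
  show ?thesis by (simp add: abs_mult sum_distrib_left)
qed

text \<open>
  If \<open>a + b > 0\<close>, the left-hand side is \<open>(sqrt a - sqrt b)\<^sup>2 / (a + b)\<close>, at most \<open>|a - b| / (a + b)\<close> and at most \<open>1\<close>.
  The first bound suffices if \<open>a + b \<ge> q\<close>; otherwise \<open>a\<close> and \<open>b\<close> are together at distance more than \<open>q\<close>
  from \<open>q\<close>, and the second bound suffices. At \<open>a = b = 0\<close> the quotient is \<open>0\<close> and the sides are \<open>1\<close> and \<open>2\<close>.
\<close>

lemma arithmetic_geometric_ratio_deviation:
  fixes a b q :: real
  assumes "a \<ge> 0" "b \<ge> 0" "q > 0"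
  shows "\<bar>2 * sqrt (a * b) / (a + b) - 1\<bar> \<le> (\<bar>a - q\<bar> + \<bar>b - q\<bar>) / q"
proof (cases "a + b = 0")
  case True
  then have "a = 0" "b = 0" using assms by auto
  then show ?thesis using assms by simp
next
  case False
  then have pos: "a + b > 0" using assms by linarith
  have am: "2 * sqrt (a * b) \<le> a + b"
    using arith_geo_mean_sqrt[OF assms(1,2)] by simp
  have gap: "a + b - 2 * sqrt (a * b) \<le> \<bar>a - b\<bar>"
  proof (cases "a \<le> b")
    case True
    then have "sqrt (a * a) \<le> sqrt (a * b)" using assms by (intro real_sqrt_le_mono mult_left_mono)
    then show ?thesis using True assms by simp
  next
    case False
    then have "sqrt (b * b) \<le> sqrt (a * b)" using assms by (intro real_sqrt_le_mono mult_right_mono) auto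
    then show ?thesis using False assms by simp
  qed
  have eq: "\<bar>2 * sqrt (a * b) / (a + b) - 1\<bar> = (a + b - 2 * sqrt (a * b)) / (a + b)"
  proof -
    have "2 * sqrt (a * b) / (a + b) \<le> 1" using pos am by (subst pos_divide_le_eq) auto
    then have "\<bar>2 * sqrt (a * b) / (a + b) - 1\<bar> = 1 - 2 * sqrt (a * b) / (a + b)" by (subst abs_of_nonpos) auto
    then show ?thesis using pos by (simp add: diff_divide_distrib)
  qed
  show ?thesis
  proof (cases "a + b \<ge> q")
    case True
    have "(a + b - 2 * sqrt (a * b)) / (a + b) \<le> (\<bar>a - q\<bar> + \<bar>b - q\<bar>) / q"
      using gap True assms am by (intro frac_le) linarith+
    then show ?thesis unfolding eq .
  next
    case False
    have "(a + b - 2 * sqrt (a * b)) / (a + b) \<le> 1" using pos assms by (simp add: divide_le_eq_1)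
    also have "1 \<le> (\<bar>a - q\<bar> + \<bar>b - q\<bar>) / q" using False assms by (simp add: le_divide_eq)
    finally show ?thesis unfolding eq .
  qed
qed

definition graph_of :: "nat \<Rightarrow> (nat set \<Rightarrow> bool) \<Rightarrow> nat set set" where
  "graph_of n w = {e \<in> vertex_pairs n. w e}"

lemma gnp_eq_map: "gnp n p = map_pmf (graph_of n) (Pi_pmf (vertex_pairs n) False (\<lambda>_. bernoulli_pmf p))"
  by (simp add: gnp_def graph_of_def[abs_def])

lemma AG1_carrier [simp]: "AG1 n E \<in> carrier_mat n n"
  by (simp add: AG1_def)

lemma AG1_sym [simp]: "(AG1 n E)\<^sup>T = AG1 n E"
  by (rule eq_matI) (auto simp: AG1_def Let_def insert_commute mult.commute add.commute)

lemma card_edges_at_vertex: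
  assumes "v \<in> {1..n}"
  shows "card {e \<in> vertex_pairs n. v \<in> e} = n - 1"
proof -
  have "{e \<in> vertex_pairs n. v \<in> e} = (\<lambda>u. {v, u}) ` ({1..n} - {v})"
  proof
    show "{e \<in> vertex_pairs n. v \<in> e} \<subseteq> (\<lambda>u. {v, u}) ` ({1..n} - {v})"
    proof
      fix e assume "e \<in> {e \<in> vertex_pairs n. v \<in> e}"
      then obtain x y where "e = {x, y}" "x \<noteq> y" "e \<subseteq> {1..n}" "v \<in> e"
        by (auto simp: vertex_pairs_def card_2_iff)
      then show "e \<in> (\<lambda>u. {v, u}) ` ({1..n} - {v})" by (cases "v = x") auto
    qed
  qed (use assms in \<open>auto simp: vertex_pairs_def\<close>)
  moreover have "inj_on (\<lambda>u. {v, u}) ({1..n} - {v})"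
    by (auto simp: inj_on_def doubleton_eq_iff)
  ultimately show ?thesis using assms by (simp add: card_image)
qed

text \<open>
  The degree changes by one with each of the \<open>n - 1\<close> possible edges at \<open>v\<close> and does not depend on the others.
\<close>

lemma vertex_degree_variance:
  assumes p: "0 < p" "p < 1" and v: "v \<in> {1..n}"
  shows "measure_pmf.expectation (Pi_pmf (vertex_pairs n) False (\<lambda>_. bernoulli_pmf p))
     (\<lambda>w. (real (vertex_degree (graph_of n w) v) - real (n - 1) * p)\<^sup>2) \<le> real (n - 1)"
proof -
  have p': "0 \<le> p" "p \<le> 1" using p by auto
  let ?E = "measure_pmf.expectation (Pi_pmf (vertex_pairs n) False (\<lambda>_. bernoulli_pmf p))"
  let ?S = "{e \<in> vertex_pairs n. v \<in> e}"
  let ?d = "\<lambda>w. real (vertex_degree (graph_of n w) v)"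
  have S: "finite ?S" by simp
  have d: "?d w = (\<Sum>e\<in>?S. of_bool (w e))" for w
  proof -
    have "{e \<in> graph_of n w. v \<in> e} = {e \<in> ?S. w e}" by (auto simp: graph_of_def)
    then show ?thesis by (simp add: vertex_degree_def sum.inter_filter[symmetric] of_bool_def)
  qed
  have "?E (\<lambda>w. of_bool (w e)) = p" if "e \<in> ?S" for e
    using that by (subst expectation_resample_coordinate[OF p' finite_vertex_pairs, of e]) auto
  then have Ed: "?E ?d = real (n - 1) * p"
    unfolding d by (subst Bochner_Integration.integral_sum) (auto simp: card_edges_at_vertex[OF v])
  have "?E (\<lambda>w. (?d w - ?E ?d)\<^sup>2) \<le> p * (1 - p) * (\<Sum>e\<in>vertex_pairs n. (of_bool (v \<in> e))\<^sup>2)"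
  proof (rule Efron_Stein_bounded_differences[OF p' finite_vertex_pairs])
    fix w :: "nat set \<Rightarrow> bool" and e assume e: "e \<in> vertex_pairs n"
    have "?d (w(e := True)) - ?d (w(e := False)) = (\<Sum>f\<in>?S. if f = e then 1 else 0)"
      unfolding d sum_subtractf[symmetric] by (intro sum.cong refl) auto
    also have "\<dots> = of_bool (v \<in> e)" using e by simp
    finally show "\<bar>?d (w(e := True)) - ?d (w(e := False))\<bar> \<le> of_bool (v \<in> e)" by simp
  qed
  also have "\<dots> \<le> 1 * real (n - 1)"
  proof (rule mult_mono)
    show "p * (1 - p) \<le> 1" using p by (intro mult_le_one) auto
    have "(\<Sum>e\<in>vertex_pairs n. (of_bool (v \<in> e) :: real)\<^sup>2) = (\<Sum>e\<in>?S. 1)"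
      by (subst sum.inter_filter) (auto intro!: sum.cong)
    then show "(\<Sum>e\<in>vertex_pairs n. (of_bool (v \<in> e) :: real)\<^sup>2) \<le> real (n - 1)"
      using card_edges_at_vertex[OF v] by simp
  qed (auto intro!: sum_nonneg)
  finally show ?thesis unfolding Ed by simp
qed

text \<open>
  Apply \<open>energy_perturbation\<close> with \<open>c = p\<close> to compare with the centred adjacency matrix: off the diagonal,
  subtracting \<open>p\<close> restores the adjacency matrix, and on the diagonal the error \<open>p\<close> contributes at most \<open>n\<close>
  to the sum of squares.
\<close>

lemma AG1_energy_deviation:
  assumes p: "0 < p" "p < 1" and n: "n > 1"
  defines "q \<equiv> real (n - 1) * p"
  shows "\<bar>energy (AG1 n (graph_of n w)) - sqrt (real n) * energy (wigner n p w)\<bar> \<le>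
    2 * real n * (\<Sum>i<n. (real (vertex_degree (graph_of n w) (Suc i)) - q)\<^sup>2) / q\<^sup>2 + 2 * real n"
proof -
  let ?M = "AG1 n (graph_of n w)" and ?B = "sqrt (real n) \<cdot>\<^sub>m wigner n p w"
  let ?x = "\<lambda>i. (real (vertex_degree (graph_of n w) (Suc i)) - q)\<^sup>2 / q\<^sup>2"
  have q: "q > 0" using p n by (simp add: q_def)
  have B: "?B \<in> carrier_mat n n" "?B\<^sup>T = ?B"
    by (simp, rule eq_matI) (auto simp: wigner_def insert_commute)
  have eB: "energy ?B = sqrt (real n) * energy (wigner n p w)"
    by (simp add: energy_smult[OF wigner_carrier wigner_sym])
  have entry: "(?M $$ (i,j) - ?B $$ (i,j) - p)\<^sup>2 \<le> 2 * ?x i + 2 * ?x j + (if i = j then 1 else 0)"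
    if ij: "i < n" "j < n" for i j
  proof (cases "i = j")
    case True
    have "{Suc i, Suc i} \<notin> graph_of n w" by (simp add: graph_of_def vertex_pairs_def)
    then have "(?M $$ (i,j) - ?B $$ (i,j) - p)\<^sup>2 = p\<^sup>2"
      using True ij by (simp add: AG1_def wigner_def)
    also have "\<dots> \<le> 1" using p by (simp add: abs_square_le_1)
    also have "\<dots> \<le> 2 * ?x i + 2 * ?x j + 1" by simp
    finally show ?thesis using True by simp
  next
    case False
    let ?a = "real (vertex_degree (graph_of n w) (Suc i))" and ?b = "real (vertex_degree (graph_of n w) (Suc j))"
    have edge: "{Suc i, Suc j} \<in> graph_of n w \<longleftrightarrow> w {Suc i, Suc j}"
      using vertex_pairsI[OF ij False] by (simp add: graph_of_def)
    have B: "?B $$ (i,j) = of_bool (w {Suc i, Suc j}) - p"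
      using ij False n by (simp add: wigner_def)
    have "\<bar>?M $$ (i,j) - ?B $$ (i,j) - p\<bar> \<le> (\<bar>?a - q\<bar> + \<bar>?b - q\<bar>) / q"
    proof (cases "w {Suc i, Suc j}")
      case True
      then have "?M $$ (i,j) - ?B $$ (i,j) - p = 2 * sqrt (?a * ?b) / (?a + ?b) - 1"
        using ij edge by (simp add: B AG1_def Let_def)
      then show ?thesis using arithmetic_geometric_ratio_deviation[of ?a ?b q] q by simp
    next
      case False
      then show ?thesis using ij edge q by (simp add: B AG1_def)
    qed
    then have "\<bar>?M $$ (i,j) - ?B $$ (i,j) - p\<bar>\<^sup>2 \<le> ((\<bar>?a - q\<bar> + \<bar>?b - q\<bar>) / q)\<^sup>2"
      by (rule power_mono) simp
    also have "\<dots> \<le> (2 * (?a - q)\<^sup>2 + 2 * (?b - q)\<^sup>2) / q\<^sup>2"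
    proof -
      have "(x + y)\<^sup>2 \<le> 2 * x\<^sup>2 + 2 * y\<^sup>2" for x y :: real
        using sum_squares_bound[of x y] by (simp add: power2_sum)
      from this[of "\<bar>?a - q\<bar>" "\<bar>?b - q\<bar>"] show ?thesis
        by (simp add: power_divide divide_right_mono)
    qed
    finally show ?thesis using False by (simp add: add_divide_distrib)
  qed
  have S: "(\<Sum>i<n. \<Sum>j<n. (?M $$ (i,j) - ?B $$ (i,j) - p)\<^sup>2) \<le> 4 * real n * (\<Sum>i<n. ?x i) + real n"
  proof -
    have "(\<Sum>i<n. \<Sum>j<n. (?M $$ (i,j) - ?B $$ (i,j) - p)\<^sup>2)
        \<le> (\<Sum>i<n. \<Sum>j<n. 2 * ?x i + 2 * ?x j + (if i = j then 1 else 0))"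
      by (intro sum_mono entry) auto
    also have "\<dots> = 4 * real n * (\<Sum>i<n. ?x i) + real n"
    proof -
      have "(\<Sum>i<n. \<Sum>j<n. 2 * f i + 2 * f j + (if i = j then 1 else 0)) = 4 * real n * (\<Sum>i<n. f i) + real n"
        for f :: "nat \<Rightarrow> real"
        by (simp add: sum.distrib sum_distrib_left[symmetric])
      then show ?thesis .
    qed
    finally show ?thesis .
  qed
  \<comment> \<open>The reverse comparison uses the constant \<open>- p\<close> and has the same sum of squares.\<close>
  have S': "(\<Sum>i<n. \<Sum>j<n. (?B $$ (i,j) - ?M $$ (i,j) - (- p))\<^sup>2) = (\<Sum>i<n. \<Sum>j<n. (?M $$ (i,j) - ?B $$ (i,j) - p)\<^sup>2)"
    by (intro sum.cong refl) (simp add: power2_eq_square algebra_simps)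
  have pn: "\<bar>p\<bar> * real n \<le> real n" using p by (simp add: mult_left_le_one_le)
  have step: "a \<le> b + (T + r) / 2 + r" if "a \<le> b + (S + r) / 2 + u" "S \<le> T" "u \<le> r" for a b S T r u :: real
    using that by argo
  have "energy ?M \<le> energy ?B + (4 * real n * (\<Sum>i<n. ?x i) + real n + real n) / 2 + real n"
    by (rule step[OF energy_perturbation[OF AG1_carrier AG1_sym B] S pn])
  moreover have "energy ?B \<le> energy ?M + (4 * real n * (\<Sum>i<n. ?x i) + real n + real n) / 2 + real n"
    using energy_perturbation[OF B AG1_carrier AG1_sym, of "graph_of n w" "- p"]
    unfolding S' abs_minus_cancel by (rule step[OF _ S pn])
  moreover have "\<bar>a - b\<bar> \<le> 2 * r * T + 2 * r"
    if "a \<le> b + (4 * r * T + r + r) / 2 + r" "b \<le> a + (4 * r * T + r + r) / 2 + r" for a b r T :: real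
    using that by (simp add: abs_le_iff add_divide_distrib algebra_simps)
  ultimately have "\<bar>energy ?M - energy ?B\<bar> \<le> 2 * real n * (\<Sum>i<n. ?x i) + 2 * real n" by blast
  then show ?thesis unfolding eB by (simp add: sum_divide_distrib[symmetric])
qed

lemma expected_AG1_energy_deviation:
  assumes p: "0 < p" "p < 1" and n: "n > 1"
  shows "measure_pmf.expectation (Pi_pmf (vertex_pairs n) False (\<lambda>_. bernoulli_pmf p))
     (\<lambda>w. \<bar>energy (AG1 n (graph_of n w)) - sqrt (real n) * energy (wigner n p w)\<bar>)
    \<le> (4 / p\<^sup>2 + 2) * real n"
proof -
  let ?E = "measure_pmf.expectation (Pi_pmf (vertex_pairs n) False (\<lambda>_. bernoulli_pmf p))"
  define q where "q = real (n - 1) * p"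
  have q: "q > 0" using p n by (simp add: q_def)
  let ?y = "\<lambda>i w. (real (vertex_degree (graph_of n w) (Suc i)) - q)\<^sup>2"
  have "?E (\<lambda>w. \<bar>energy (AG1 n (graph_of n w)) - sqrt (real n) * energy (wigner n p w)\<bar>)
      \<le> ?E (\<lambda>w. 2 * real n * (\<Sum>i<n. ?y i w) / q\<^sup>2 + 2 * real n)"
    by (rule integral_mono) (auto intro: AG1_energy_deviation[OF p n, folded q_def])
  also have "\<dots> = 2 * real n * (\<Sum>i<n. ?E (?y i)) / q\<^sup>2 + 2 * real n"
    by (simp add: integral_sum)
  also have "\<dots> \<le> 2 * real n * (\<Sum>i<n. real (n - 1)) / q\<^sup>2 + 2 * real n"
  proof (intro add_right_mono divide_right_mono mult_left_mono sum_mono)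
    fix i assume "i \<in> {..<n}"
    then show "?E (?y i) \<le> real (n - 1)"
      unfolding q_def by (intro vertex_degree_variance[OF p]) auto
  qed auto
  also have "\<dots> = 2 * real n / p\<^sup>2 * (real n / real (n - 1)) + 2 * real n"
  proof -
    have "2 * x * (x * m) / (m * p)\<^sup>2 = 2 * x / p\<^sup>2 * (x / m)" if "m > 0" for x m :: real
      using that p by (simp add: field_simps power2_eq_square)
    from this[of "real (n - 1)" "real n"] show ?thesis
      using n unfolding q_def by simp
  qed
  also have "\<dots> \<le> 2 * real n / p\<^sup>2 * 2 + 2 * real n"
    using n by (intro add_right_mono mult_left_mono) (auto simp: divide_le_eq of_nat_diff)
  finally show ?thesis by (simp add: algebra_simps)
qed

lemma AG1_energy_L1_limit:
  assumes p: "0 < p" "p < 1"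
  shows "(\<lambda>n. measure_pmf.expectation (Pi_pmf (vertex_pairs n) False (\<lambda>_. bernoulli_pmf p))
     (\<lambda>w. \<bar>energy (AG1 n (graph_of n w)) / real n powr (3/2) - 8 / (3 * pi) * sqrt (p * (1 - p))\<bar>)) \<longlonglongrightarrow> 0"
proof -
  let ?E = "\<lambda>n. measure_pmf.expectation (Pi_pmf (vertex_pairs n) False (\<lambda>_. bernoulli_pmf p))"
  let ?c = "8 / (3 * pi) * sqrt (p * (1 - p))"
  let ?W = "\<lambda>n w. \<bar>energy (wigner n p w) / real n - ?c\<bar>"
  let ?D = "\<lambda>n w. \<bar>energy (AG1 n (graph_of n w)) - sqrt (real n) * energy (wigner n p w)\<bar>"
  let ?A = "\<lambda>n w. \<bar>energy (AG1 n (graph_of n w)) / real n powr (3/2) - ?c\<bar>"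
  have bound: "?E n (?A n) \<le> (4 / p\<^sup>2 + 2) / sqrt (real n) + ?E n (?W n)" if n: "n > 1" for n
  proof -
    have pw: "real n powr (3/2) = real n * sqrt (real n)"
      using n powr_add[of "real n" 1 "1/2"] by (simp add: powr_half_sqrt)
    have "?E n (?A n) \<le> ?E n (\<lambda>w. ?D n w / (real n * sqrt (real n)) + ?W n w)"
    proof (rule integral_mono)
      fix w
      have eq: "energy (AG1 n (graph_of n w)) / (real n * sqrt (real n)) - ?c
        = (energy (AG1 n (graph_of n w)) - sqrt (real n) * energy (wigner n p w)) / (real n * sqrt (real n))
          + (energy (wigner n p w) / real n - ?c)"
        using n by (simp add: diff_divide_distrib)
      have "?A n w \<le> \<bar>(energy (AG1 n (graph_of n w)) - sqrt (real n) * energy (wigner n p w)) / (real n * sqrt (real n))\<bar>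
          + ?W n w"
        unfolding pw eq by (rule abs_triangle_ineq)
      then show "?A n w \<le> ?D n w / (real n * sqrt (real n)) + ?W n w"
        by (simp only: abs_divide abs_mult abs_of_nat abs_of_nonneg[OF real_sqrt_ge_zero[OF of_nat_0_le_iff]])
    qed auto
    also have "\<dots> = ?E n (?D n) / (real n * sqrt (real n)) + ?E n (?W n)" by simp
    also have "\<dots> \<le> (4 / p\<^sup>2 + 2) * real n / (real n * sqrt (real n)) + ?E n (?W n)"
      by (intro add_right_mono divide_right_mono expected_AG1_energy_deviation[OF p n]) auto
    also have "\<dots> = (4 / p\<^sup>2 + 2) / sqrt (real n) + ?E n (?W n)" using n by simp
    finally show ?thesis .
  qed
  have "(\<lambda>n. (4 / p\<^sup>2 + 2) / sqrt (real n)) \<longlonglongrightarrow> 0" by real_asymp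
  then have upper: "(\<lambda>n. (4 / p\<^sup>2 + 2) / sqrt (real n) + ?E n (?W n)) \<longlonglongrightarrow> 0"
    by (rule tendsto_add_zero[OF _ wigner_energy_L1_limit[OF p]])
  show ?thesis
  proof (rule tendsto_sandwich[OF _ _ tendsto_const upper])
    show "eventually (\<lambda>n. 0 \<le> ?E n (?A n)) sequentially"
      by (intro always_eventually allI integral_nonneg_AE) simp
    show "eventually (\<lambda>n. ?E n (?A n) \<le> (4 / p\<^sup>2 + 2) / sqrt (real n) + ?E n (?W n)) sequentially"
      using bound by (auto simp: eventually_sequentially intro!: exI[of _ 2])
  qed
qed

theorem corollary10:
  fixes p :: real
  assumes "0 < p" and "p < 1"
  shows "\<forall>\<epsilon>>0.
    (\<lambda>n. measure_pmf.prob (gnp n p)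
       {E. \<bar>energy (AG1 n E) / (8 / (3 * pi) * sqrt (p * (1 - p)) * real n powr (3 / 2)) - 1\<bar> > \<epsilon>})
    \<longlonglongrightarrow> 0"
proof (intro allI impI)
  fix \<epsilon> :: real assume eps: "\<epsilon> > 0"
  let ?P = "\<lambda>n. Pi_pmf (vertex_pairs n) False (\<lambda>_. bernoulli_pmf p)"
  define c where "c = 8 / (3 * pi) * sqrt (p * (1 - p))"
  have c: "c > 0" using assms by (simp add: c_def)
  let ?A = "\<lambda>n w. \<bar>energy (AG1 n (graph_of n w)) / real n powr (3/2) - c\<bar>"
  let ?S = "\<lambda>n. {E. \<bar>energy (AG1 n E) / (c * real n powr (3 / 2)) - 1\<bar> > \<epsilon>}"
  have markov: "measure_pmf.prob (gnp n p) (?S n) \<le> measure_pmf.expectation (?P n) (?A n) / (c * \<epsilon>)" for n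
  proof -
    have "measure_pmf.prob (gnp n p) (?S n) = measure_pmf.prob (?P n) (graph_of n -` ?S n)"
      unfolding gnp_eq_map by (simp add: measure_map_pmf)
    also have "\<dots> \<le> measure_pmf.prob (?P n) {w \<in> space (measure_pmf (?P n)). ?A n w \<ge> c * \<epsilon>}"
    proof (rule measure_pmf.finite_measure_mono)
      show "graph_of n -` ?S n \<subseteq> {w \<in> space (measure_pmf (?P n)). ?A n w \<ge> c * \<epsilon>}"
      proof safe
        fix w assume "\<epsilon> < \<bar>energy (AG1 n (graph_of n w)) / (c * real n powr (3 / 2)) - 1\<bar>"
        then have "c * \<epsilon> \<le> \<bar>c\<bar> * \<bar>energy (AG1 n (graph_of n w)) / (c * real n powr (3 / 2)) - 1\<bar>"
          using c by simp
        also have "\<dots> = ?A n w"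
          unfolding abs_mult[symmetric] using c by (simp add: right_diff_distrib)
        finally show "c * \<epsilon> \<le> ?A n w" .
      qed simp
    qed simp
    also have "\<dots> \<le> measure_pmf.expectation (?P n) (?A n) / (c * \<epsilon>)"
      using c eps by (intro integral_Markov_inequality_measure[where A = UNIV]) auto
    finally show ?thesis .
  qed
  have lim: "(\<lambda>n. measure_pmf.expectation (?P n) (?A n) / (c * \<epsilon>)) \<longlonglongrightarrow> 0"
    unfolding c_def by (rule tendsto_divide_zero[OF AG1_energy_L1_limit[OF assms]])
  show "(\<lambda>n. measure_pmf.prob (gnp n p)
       {E. \<bar>energy (AG1 n E) / (8 / (3 * pi) * sqrt (p * (1 - p)) * real n powr (3 / 2)) - 1\<bar> > \<epsilon>}) \<longlonglongrightarrow> 0"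
    unfolding c_def[symmetric]
    by (rule tendsto_sandwich[OF _ _ tendsto_const lim]) (simp_all add: markov)
qed

end
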